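(* Let $-\infty<a<b<\infty$, let $p=1$ on $(a,b)$, and let $q,w\in L^1(a,b)$ be real-valued with $w\neq 0$ a.e. on $(a,b)$, such that both $\{x\in(a,b):w(x)>0\}$ and $\{x\in(a,b):w(x)<0\}$ have positive Lebesgue measure. Assume that $\int_a^b w\neq0$ and that $w$ has $n$ turning points in $(a,b)$. Let $\mathcal{D}$ be a selfadjoint domain, let $c(\mathcal{D})$ be the associated constant, and set $$\alpha:=c(\mathcal{D})+\|q_-\|_1,\qquad \delta:=2+2\,\frac{\|w\|_1}{\bigl|\int_a^b w\bigr|},$$ where $q_-(x):=\min\{0,q(x)\}$. Let $\varepsilon>0$ be such that $$\mu_1\bigl(\{x\in(a,b):|w(x)|<\varepsilon\}\bigr)\le\frac{1}{4\alpha\delta^2},$$ where $\mu_1$ is Lebesgue measure. Then every eigenvalue $\lambda\in\mathbb{C}\setminus\mathbb{R}$ of the operator $A(\mathcal{D})$ satisfies $$|\operatorname{Im}\lambda|\le\frac{8}{\varepsilon}\,\alpha^2\,\delta^3\,(n+1)\qquad\text{and}\qquad|\operatorname{Re}\lambda|\le\frac{2}{\varepsilon}\,\alpha\,\delta^2\bigl(4\,\alpha\,\delta\,(n+1)+\alpha+\|q\|_1\bigr).$$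
   Context: Turning points: $w$ has $n$ turning points $x_1<\dots<x_n$ in $(a,b)$ if, with $x_0:=a$ and $x_{n+1}:=b$, $\operatorname{sgn}(w)$ is (a.e.) constant on each of the intervals $(x_k,x_{k+1})$, $k=0,\dots,n$, and changes from each of these intervals to the next. Notation: $\|\cdot\|_1$ is the $L^1$-norm on $(a,b)$. $L^2_{|w|}(a,b)$ is the $L^2$-space on $(a,b)$ with respect to the measure $|w|\,dt$. Differential expression (here with $p=1$): $\tau(f)=\frac1w\bigl(-f''+qf\bigr)$. The maximal domain $\mathcal{D}_{\max}$ is the set of all $f:(a,b)\to\mathbb{C}$ in $L^2_{|w|}(a,b)$ such that $f$ and $f'$ are absolutely continuous on $[a,b]$ and $\tau(f)\in L^2_{|w|}(a,b)$. A selfadjoint domain is a set $\mathcal{D}$ of one of the following two forms: (separated) $\mathcal{D}_{\rm sep}(l,r)=\{f\in\mathcal{D}_{\max}:f'(a)=lf(a),\ f'(b)=rf(b)\}$ with $l,r\in\mathbb{R}\cup\{\infty\}$, where $l=\infty$ (resp. $r=\infty$) means the Dirichlet condition $f(a)=0$ (resp. $f(b)=0$); (coupled) $\mathcal{D}_{\rm coup}(\varphi,R)=\left\{f\in\mathcal{D}_{\max}:\begin{pmatrix} f(b) \\ f'(b) \end{pmatrix}=e^{i\varphi}R\begin{pmatrix} f(a) \\ f'(a) \end{pmatrix}\right\}$ with $\varphi\in[0,2\pi)$ and $R=(r_{ij})_{i,j=1}^2\in\mathbb{R}^{2\times2}$, $\det R=1$. The constant $c(\mathcal{D})\ge0$ is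 defined by: $c(\mathcal{D})=|l|+|r|$ if $\mathcal{D}=\mathcal{D}_{\rm sep}(l,r)$ with $l,r\in\mathbb{R}$; $c(\mathcal{D})=|r|$ if $\mathcal{D}=\mathcal{D}_{\rm sep}(\infty,r)$ with $r\in\mathbb{R}$; $c(\mathcal{D})=|l|$ if $\mathcal{D}=\mathcal{D}_{\rm sep}(l,\infty)$ with $l\in\mathbb{R}$; $c(\mathcal{D})=0$ if $\mathcal{D}=\mathcal{D}_{\rm sep}(\infty,\infty)$; $c(\mathcal{D})=\frac{|r_{11}|+|r_{22}|+2}{|r_{12}|}$ if $\mathcal{D}=\mathcal{D}_{\rm coup}(\varphi,R)$ and $r_{12}\ne0$; $c(\mathcal{D})=|r_{11}r_{21}|$ if $\mathcal{D}=\mathcal{D}_{\rm coup}(\varphi,R)$ and $r_{12}=0$. The operator $A(\mathcal{D})$ in $L^2_{|w|}(a,b)$ is $A(\mathcal{D})f=\tau(f)$ with $\operatorname{dom}A(\mathcal{D})=\mathcal{D}$. Thus $\lambda$ is an eigenvalue of $A(\mathcal{D})$ iff there is $\phi\in\mathcal{D}$, $\phi\neq0$, with $-\phi''+q\phi=\lambda w\phi$ a.e. on $(a,b)$. *)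

theory Defs
  imports "HOL-Analysis.Analysis"
begin

abbreviation leb :: "real \<Rightarrow> real \<Rightarrow> real measure" where
  "leb a b \<equiv> lebesgue_on {a<..<b}"

definition L1_norm :: "real \<Rightarrow> real \<Rightarrow> (real \<Rightarrow> real) \<Rightarrow> real" where
  "L1_norm a b f = (\<integral>x. \<bar>f x\<bar> \<partial>leb a b)"

definition L2_weighted :: "real \<Rightarrow> real \<Rightarrow> (real \<Rightarrow> real) \<Rightarrow> (real \<Rightarrow> complex) set" where
  "L2_weighted a b w =
     {f. f \<in> borel_measurable (density (leb a b) (\<lambda>x. ennreal \<bar>w x\<bar>)) \<and>
         integrable (density (leb a b) (\<lambda>x. ennreal \<bar>w x\<bar>)) (\<lambda>x. (cmod (f x))\<^sup>2)}"

definition abs_cont_on :: "real \<Rightarrow> real \<Rightarrow> (real \<Rightarrow> complex) \<Rightarrow> bool" where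
  "abs_cont_on a b f \<longleftrightarrow>
     (\<forall>e>0. \<exists>d>0. \<forall>S :: (real \<times> real) set.
        finite S \<and> (\<forall>(u, v)\<in>S. a \<le> u \<and> u \<le> v \<and> v \<le> b) \<and>
        disjoint_family_on (\<lambda>(u, v). {u<..<v}) S \<and> (\<Sum>(u, v)\<in>S. v - u) < d \<longrightarrow>
        (\<Sum>(u, v)\<in>S. cmod (f v - f u)) < e)"

text \<open>The sign of \<open>w\<close> on the k-th interval is \<open>s k\<close>.\<close>

definition has_turning_points :: "real \<Rightarrow> real \<Rightarrow> (real \<Rightarrow> real) \<Rightarrow> nat \<Rightarrow> bool" where
  "has_turning_points a b w n \<longleftrightarrow>
     (\<exists>(x :: nat \<Rightarrow> real) (s :: nat \<Rightarrow> real).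
        x 0 = a \<and> x (Suc n) = b \<and> (\<forall>k\<le>n. x k < x (Suc k)) \<and>
        (\<forall>k\<le>n. AE t in leb (x k) (x (Suc k)). sgn (w t) = s k) \<and>
        (\<forall>k<n. s k \<noteq> s (Suc k)))"

text \<open>
  Functions on \<open>(a,b)\<close> whose derivative is absolutely continuous on \<open>[a,b]\<close> extend to \<open>[a,b]\<close>
  together with their derivative. They are represented by total functions of which only the
  values on \<open>[a,b]\<close> matter; the derivative is one-sided at the end points.
\<close>

definition deriv_on :: "real \<Rightarrow> real \<Rightarrow> (real \<Rightarrow> complex) \<Rightarrow> real \<Rightarrow> complex" where
  "deriv_on a b f x = vector_derivative f (at x within {a..b})"

text \<open>
  \<open>is_tau a b q w f g\<close> says that \<open>g = (- f'' + q f) / w\<close> almost everywhere. The second derivative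
  exists only almost everywhere, so it is given as a relation and not by the total
  \<open>vector_derivative\<close>, whose value at points of non-differentiability is arbitrary.
\<close>

definition is_tau :: "real \<Rightarrow> real \<Rightarrow> (real \<Rightarrow> real) \<Rightarrow> (real \<Rightarrow> real) \<Rightarrow>
    (real \<Rightarrow> complex) \<Rightarrow> (real \<Rightarrow> complex) \<Rightarrow> bool" where
  "is_tau a b q w f g \<longleftrightarrow>
     (AE x in leb a b. \<exists>f2. (deriv_on a b f has_vector_derivative f2) (at x) \<and>
        g x = 1 / complex_of_real (w x) * (- f2 + complex_of_real (q x) * f x))"

definition D_max :: "real \<Rightarrow> real \<Rightarrow> (real \<Rightarrow> real) \<Rightarrow> (real \<Rightarrow> real) \<Rightarrow> (real \<Rightarrow> complex) set" where
  "D_max a b q w =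
     {f. f \<in> L2_weighted a b w \<and>
         (\<forall>x\<in>{a..b}. f differentiable (at x within {a..b})) \<and>
         abs_cont_on a b f \<and> abs_cont_on a b (deriv_on a b f) \<and>
         (\<exists>g\<in>L2_weighted a b w. is_tau a b q w f g)}"

text \<open>
  Parameters of the separated boundary conditions range over the reals with one extra point
  \<open>Infinite\<close>, which encodes the Dirichlet condition.
\<close>

datatype slope = Finite real | Infinite

datatype boundary_data = Sep slope slope | Coup real "real^2^2"

fun slope_cond :: "slope \<Rightarrow> complex \<Rightarrow> complex \<Rightarrow> bool" where
  "slope_cond (Finite l) y y' \<longleftrightarrow> y' = complex_of_real l * y"
| "slope_cond Infinite y y' \<longleftrightarrow> y = 0"

fun valid_boundary_data :: "boundary_data \<Rightarrow> bool" where
  "valid_boundary_data (Sep l r) \<longleftrightarrow> True"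
| "valid_boundary_data (Coup \<phi> R) \<longleftrightarrow> 0 \<le> \<phi> \<and> \<phi> < 2 * pi \<and> det R = 1"

fun sa_domain :: "real \<Rightarrow> real \<Rightarrow> (real \<Rightarrow> real) \<Rightarrow> (real \<Rightarrow> real) \<Rightarrow> boundary_data \<Rightarrow>
    (real \<Rightarrow> complex) set" where
  "sa_domain a b q w (Sep l r) =
     {f \<in> D_max a b q w. slope_cond l (f a) (deriv_on a b f a) \<and>
                         slope_cond r (f b) (deriv_on a b f b)}"
| "sa_domain a b q w (Coup \<phi> R) =
     {f \<in> D_max a b q w.
        f b = exp (\<i> * complex_of_real \<phi>) *
          (complex_of_real (R$1$1) * f a + complex_of_real (R$1$2) * deriv_on a b f a) \<and>
        deriv_on a b f b = exp (\<i> * complex_of_real \<phi>) *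
          (complex_of_real (R$2$1) * f a + complex_of_real (R$2$2) * deriv_on a b f a)}"

text \<open>
  The constant is a function of the boundary data. It depends on the domain only: coupled data
  \<open>(\<phi>, R)\<close> are determined by the domain up to adding \<open>\<pi>\<close> to \<open>\<phi>\<close> (modulo \<open>2\<pi>\<close>)
  and replacing \<open>R\<close> by \<open>- R\<close>.
\<close>

fun c_const :: "boundary_data \<Rightarrow> real" where
  "c_const (Sep (Finite l) (Finite r)) = \<bar>l\<bar> + \<bar>r\<bar>"
| "c_const (Sep Infinite (Finite r)) = \<bar>r\<bar>"
| "c_const (Sep (Finite l) Infinite) = \<bar>l\<bar>"
| "c_const (Sep Infinite Infinite) = 0"
| "c_const (Coup \<phi> R) =
     (if R$1$2 \<noteq> 0 then (\<bar>R$1$1\<bar> + \<bar>R$2$2\<bar> + 2) / \<bar>R$1$2\<bar> else \<bar>R$1$1 * R$2$1\<bar>)"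

text \<open>
  \<open>D\<close> is the domain of the operator. Elements of \<open>D\<close> are continuous, so being non-zero at some
  point is the same as being non-zero as an element of the \<open>L\<^sup>2\<close>-space.
\<close>

definition is_eigenvalue :: "real \<Rightarrow> real \<Rightarrow> (real \<Rightarrow> real) \<Rightarrow> (real \<Rightarrow> real) \<Rightarrow>
    (real \<Rightarrow> complex) set \<Rightarrow> complex \<Rightarrow> bool" where
  "is_eigenvalue a b q w D lam \<longleftrightarrow>
     (\<exists>f\<in>D. (\<exists>x\<in>{a<..<b}. f x \<noteq> 0) \<and> is_tau a b q w f (\<lambda>x. lam * f x))"

end

theory Submission
  imports Defs
begin

text \<open>
  Let \<open>f\<close> be an eigenfunction for a nonreal eigenvalue \<open>\<lambda>\<close>. Pairing the equation with \<open>f\<close> gives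
  \<open>\<integral>|f'|\<^sup>2 + q |f|\<^sup>2 = \<lambda> \<integral>w |f|\<^sup>2 + [f' f\<^sup>*]\<close> with a real boundary term, so \<open>\<integral>w |f|\<^sup>2 = 0\<close> and
  \<open>\<parallel>f'\<parallel>\<^sub>2\<^sup>2 \<le> \<alpha> \<parallel>f\<parallel>\<^sub>\<infinity>\<^sup>2\<close>. As \<open>\<integral>w |f|\<^sup>2 = 0\<close>, also
  \<open>|f(x)|\<^sup>2 \<integral>w = \<integral>w(t) (|f(x)|\<^sup>2 - |f(t)|\<^sup>2) dt\<close>, which bounds \<open>\<parallel>f\<parallel>\<^sub>\<infinity>\<^sup>2\<close> by a multiple of
  \<open>\<parallel>f\<parallel>\<^sub>2 \<parallel>f'\<parallel>\<^sub>2\<close>. Hence \<open>\<parallel>f\<parallel>\<^sub>\<infinity>\<^sup>2 \<le> \<alpha> \<delta>\<^sup>2 \<parallel>f\<parallel>\<^sub>2\<^sup>2\<close> and \<open>\<parallel>f'\<parallel>\<^sub>2 \<le> \<alpha> \<delta> \<parallel>f\<parallel>\<^sub>2\<close>.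

  On each interval between consecutive turning points, pair the equation with \<open>g f\<close>, where \<open>g\<close> is
  the distance to the end points divided by \<open>h\<close> and cut off at 1. There are no boundary terms, and
  \<open>\<lambda> \<integral>g w |f|\<^sup>2\<close> is bounded by \<open>\<parallel>f\<parallel>\<^sub>2\<close>, \<open>\<parallel>f'\<parallel>\<^sub>2\<close> and \<open>|g'| \<le> 1/h\<close>, while
  \<open>|\<integral>g w |f|\<^sup>2| = \<integral>g |w| |f|\<^sup>2\<close> is at least \<open>\<epsilon>\<close> times \<open>\<integral>|f|\<^sup>2\<close> minus the losses where \<open>g < 1\<close> or
  \<open>|w| < \<epsilon>\<close>. Summing over the intervals, each kind of loss is a quarter of \<open>\<parallel>f\<parallel>\<^sub>2\<^sup>2\<close> for
  \<open>h = 1 / (4 \<alpha> \<delta>\<^sup>2 (n + 1))\<close>.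
\<close>

section \<open>Absolute continuity and the fundamental theorem of calculus\<close>

lemma abs_cont_onD:
  assumes "abs_cont_on a b f" "e > 0"
  obtains d where "d > 0"
    "\<And>S. \<lbrakk>finite S; \<And>u v. (u, v) \<in> S \<Longrightarrow> a \<le> u \<and> u \<le> v \<and> v \<le> b;
           disjoint_family_on (\<lambda>(u, v). {u<..<v}) S; (\<Sum>(u, v)\<in>S. v - u) < d\<rbrakk>
        \<Longrightarrow> (\<Sum>(u, v)\<in>S. cmod (f v - f u)) < e"
proof -
  from assms obtain d where d: "d > 0" "\<forall>S. finite S \<and> (\<forall>(u, v)\<in>S. a \<le> u \<and> u \<le> v \<and> v \<le> b) \<and>
        disjoint_family_on (\<lambda>(u, v). {u<..<v}) S \<and> (\<Sum>(u, v)\<in>S. v - u) < d \<longrightarrow>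
        (\<Sum>(u, v)\<in>S. cmod (f v - f u)) < e"
    unfolding abs_cont_on_def by meson
  show thesis
    by (rule that[OF d(1)], rule d(2)[rule_format]) auto
qed

lemma abs_cont_on_subset:
  assumes "abs_cont_on a b f" "a \<le> c" "d \<le> b"
  shows "abs_cont_on c d f"
  unfolding abs_cont_on_def
proof (intro allI impI)
  fix e :: real
  assume "e > 0"
  then obtain r where r: "r > 0"
    "\<And>S. \<lbrakk>finite S; \<And>u v. (u, v) \<in> S \<Longrightarrow> a \<le> u \<and> u \<le> v \<and> v \<le> b;
           disjoint_family_on (\<lambda>(u, v). {u<..<v}) S; (\<Sum>(u, v)\<in>S. v - u) < r\<rbrakk>
        \<Longrightarrow> (\<Sum>(u, v)\<in>S. cmod (f v - f u)) < e"
    using abs_cont_onD[OF assms(1)] by blast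
  show "\<exists>r>0. \<forall>S. finite S \<and> (\<forall>(u, v)\<in>S. c \<le> u \<and> u \<le> v \<and> v \<le> d) \<and>
        disjoint_family_on (\<lambda>(u, v). {u<..<v}) S \<and> (\<Sum>(u, v)\<in>S. v - u) < r \<longrightarrow>
        (\<Sum>(u, v)\<in>S. cmod (f v - f u)) < e"
    using assms(2,3) by (intro exI[of _ r] conjI r(1) allI impI r(2)) fastforce+
qed

lemma abs_cont_on_imp_continuous_on:
  assumes "abs_cont_on a b f"
  shows "continuous_on {a..b} f"
  unfolding continuous_on_iff
proof (intro ballI allI impI)
  fix x e :: real
  assume x: "x \<in> {a..b}" and "e > 0"
  with assms obtain r where r: "r > 0"
    "\<And>S. \<lbrakk>finite S; \<And>u v. (u, v) \<in> S \<Longrightarrow> a \<le> u \<and> u \<le> v \<and> v \<le> b;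
           disjoint_family_on (\<lambda>(u, v). {u<..<v}) S; (\<Sum>(u, v)\<in>S. v - u) < r\<rbrakk>
        \<Longrightarrow> (\<Sum>(u, v)\<in>S. cmod (f v - f u)) < e"
    using abs_cont_onD by blast
  have *: "dist (f v) (f u) < e" if "u \<in> {a..b}" "v \<in> {a..b}" "u \<le> v" "v - u < r" for u v
    using r(2)[of "{(u, v)}"] that by (auto simp: dist_norm disjoint_family_on_def)
  show "\<exists>d>0. \<forall>y\<in>{a..b}. dist y x < d \<longrightarrow> dist (f y) (f x) < e"
  proof (intro exI[of _ r] conjI r(1) ballI impI)
    fix y assume "y \<in> {a..b}" "dist y x < r"
    then show "dist (f y) (f x) < e"
      using *[of x y] *[of y x] x by (cases "x \<le> y") (auto simp: dist_commute dist_real_def)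
  qed
qed

lemma abs_cont_on_mult:
  assumes f: "abs_cont_on a b f" and g: "abs_cont_on a b g"
  shows "abs_cont_on a b (\<lambda>x. f x * g x)"
  unfolding abs_cont_on_def
proof (intro allI impI)
  fix e :: real
  assume e: "e > 0"
  have "bounded (f ` {a..b})" "bounded (g ` {a..b})"
    using f g by (auto intro!: compact_imp_bounded compact_continuous_image abs_cont_on_imp_continuous_on)
  then obtain A B where A: "\<And>x. x \<in> {a..b} \<Longrightarrow> cmod (f x) \<le> A"
    and B: "\<And>x. x \<in> {a..b} \<Longrightarrow> cmod (g x) \<le> B"
    unfolding bounded_iff by (metis imageI)
  \<comment> \<open>The 1 keeps \<open>M\<close> positive, so that each of the two increments can be
    given the share \<open>e / (2 * M)\<close>.\<close>
  define M where "M = max 1 (max A B)"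
  have M: "M > 0" "\<And>x. x \<in> {a..b} \<Longrightarrow> cmod (f x) \<le> M" "\<And>x. x \<in> {a..b} \<Longrightarrow> cmod (g x) \<le> M"
    using A B by (fastforce simp: M_def)+
  have e': "e / (2 * M) > 0"
    using e M(1) by simp
  obtain r where r: "r > 0"
    "\<And>S. \<lbrakk>finite S; \<And>u v. (u, v) \<in> S \<Longrightarrow> a \<le> u \<and> u \<le> v \<and> v \<le> b;
           disjoint_family_on (\<lambda>(u, v). {u<..<v}) S; (\<Sum>(u, v)\<in>S. v - u) < r\<rbrakk>
        \<Longrightarrow> (\<Sum>(u, v)\<in>S. cmod (f v - f u)) < e / (2 * M)"
    using abs_cont_onD[OF f e'] by blast
  obtain t where t: "t > 0"
    "\<And>S. \<lbrakk>finite S; \<And>u v. (u, v) \<in> S \<Longrightarrow> a \<le> u \<and> u \<le> v \<and> v \<le> b;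
           disjoint_family_on (\<lambda>(u, v). {u<..<v}) S; (\<Sum>(u, v)\<in>S. v - u) < t\<rbrakk>
        \<Longrightarrow> (\<Sum>(u, v)\<in>S. cmod (g v - g u)) < e / (2 * M)"
    using abs_cont_onD[OF g e'] by blast
  show "\<exists>r>0. \<forall>S. finite S \<and> (\<forall>(u, v)\<in>S. a \<le> u \<and> u \<le> v \<and> v \<le> b) \<and>
        disjoint_family_on (\<lambda>(u, v). {u<..<v}) S \<and> (\<Sum>(u, v)\<in>S. v - u) < r \<longrightarrow>
        (\<Sum>(u, v)\<in>S. cmod (f v * g v - f u * g u)) < e"
  proof (intro exI[of _ "min r t"] conjI allI impI)
    fix S :: "(real \<times> real) set"
    assume "finite S \<and> (\<forall>(u, v)\<in>S. a \<le> u \<and> u \<le> v \<and> v \<le> b) \<and>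
        disjoint_family_on (\<lambda>(u, v). {u<..<v}) S \<and> (\<Sum>(u, v)\<in>S. v - u) < min r t"
    then have S: "finite S" "\<And>u v. (u, v) \<in> S \<Longrightarrow> a \<le> u \<and> u \<le> v \<and> v \<le> b"
      "disjoint_family_on (\<lambda>(u, v). {u<..<v}) S" "(\<Sum>(u, v)\<in>S. v - u) < r" "(\<Sum>(u, v)\<in>S. v - u) < t"
      by auto
    have "cmod (f v * g v - f u * g u) \<le> M * cmod (g v - g u) + M * cmod (f v - f u)"
      if "(u, v) \<in> S" for u v
    proof -
      have uv: "u \<in> {a..b}" "v \<in> {a..b}"
        using S(2)[OF that] by auto
      have "f v * g v - f u * g u = f v * (g v - g u) + g u * (f v - f u)"
        by (simp add: algebra_simps)
      then have "cmod (f v * g v - f u * g u) \<le> cmod (f v) * cmod (g v - g u) + cmod (g u) * cmod (f v - f u)"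
        by (metis norm_mult norm_triangle_ineq)
      also have "\<dots> \<le> M * cmod (g v - g u) + M * cmod (f v - f u)"
        by (intro add_mono mult_right_mono M uv) auto
      finally show ?thesis .
    qed
    then have "(\<Sum>(u, v)\<in>S. cmod (f v * g v - f u * g u))
        \<le> (\<Sum>(u, v)\<in>S. M * cmod (g v - g u) + M * cmod (f v - f u))"
      by (intro sum_mono) auto
    also have "\<dots> = M * (\<Sum>(u, v)\<in>S. cmod (g v - g u)) + M * (\<Sum>(u, v)\<in>S. cmod (f v - f u))"
      by (simp add: sum.distrib sum_distrib_left case_prod_unfold)
    also have "\<dots> < M * (e / (2 * M)) + M * (e / (2 * M))"
      by (intro add_strict_mono mult_strict_left_mono M(1) t(2) r(2) S)
    also have "\<dots> = e"
      using M(1) by (simp add: field_simps)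
    finally show "(\<Sum>(u, v)\<in>S. cmod (f v * g v - f u * g u)) < e" .
  qed (use r t in auto)
qed

lemma abs_cont_on_cnj:
  assumes "abs_cont_on a b f"
  shows "abs_cont_on a b (\<lambda>x. cnj (f x))"
proof -
  have "cmod (cnj (f v) - cnj (f u)) = cmod (f v - f u)" for u v
    by (metis complex_cnj_diff complex_mod_cnj)
  then show ?thesis
    using assms unfolding abs_cont_on_def by simp
qed

text \<open>Makes real cut-off functions admissible factors in products of absolutely continuous
  functions.\<close>

lemma abs_cont_on_lipschitz:
  fixes f :: "real \<Rightarrow> complex"
  assumes "C-lipschitz_on {a..b} f"
  shows "abs_cont_on a b f"
  unfolding abs_cont_on_def
proof (intro allI impI)
  fix e :: real
  assume e: "e > 0"
  have C: "C \<ge> 0"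
    using assms by (rule lipschitz_on_nonneg)
  show "\<exists>r>0. \<forall>S. finite S \<and> (\<forall>(u, v)\<in>S. a \<le> u \<and> u \<le> v \<and> v \<le> b) \<and>
        disjoint_family_on (\<lambda>(u, v). {u<..<v}) S \<and> (\<Sum>(u, v)\<in>S. v - u) < r \<longrightarrow>
        (\<Sum>(u, v)\<in>S. cmod (f v - f u)) < e"
  \<comment> \<open>Dividing by \<open>C + 1\<close> covers the case \<open>C = 0\<close>.\<close>
  proof (intro exI[of _ "e / (C + 1)"] conjI allI impI)
    fix S :: "(real \<times> real) set"
    assume S: "finite S \<and> (\<forall>(u, v)\<in>S. a \<le> u \<and> u \<le> v \<and> v \<le> b) \<and>
        disjoint_family_on (\<lambda>(u, v). {u<..<v}) S \<and> (\<Sum>(u, v)\<in>S. v - u) < e / (C + 1)"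
    have "cmod (f v - f u) \<le> (C + 1) * (v - u)" if "(u, v) \<in> S" for u v
    proof -
      have "cmod (f v - f u) \<le> C * (v - u)"
        using S that lipschitz_onD[OF assms, of v u] by (auto simp: dist_norm)
      also have "\<dots> \<le> (C + 1) * (v - u)"
        using S that by (intro mult_right_mono) auto
      finally show ?thesis .
    qed
    then have "(\<Sum>(u, v)\<in>S. cmod (f v - f u)) \<le> (\<Sum>(u, v)\<in>S. (C + 1) * (v - u))"
      by (intro sum_mono) auto
    also have "\<dots> = (C + 1) * (\<Sum>(u, v)\<in>S. v - u)"
      by (simp add: sum_distrib_left case_prod_unfold)
    also have "\<dots> < e"
      using S C by (simp add: field_simps)
    finally show "(\<Sum>(u, v)\<in>S. cmod (f v - f u)) < e" .
  qed (use e C in auto)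
qed

text \<open>
  Off the null set \<open>N\<close> the usual straddle argument applies. Tags in \<open>N\<close> are kept inside an open
  set of small measure by the gauge, so absolute continuity makes their contribution small.
\<close>

theorem abs_cont_on_fundamental_theorem:
  fixes F :: "real \<Rightarrow> complex"
  assumes ab: "a \<le> b" and ac: "abs_cont_on a b F" and N: "negligible N"
    and deriv: "\<And>x. x \<in> {a..b} - N \<Longrightarrow> (F has_vector_derivative f x) (at x within {a..b})"
  shows "(f has_integral (F b - F a)) {a..b}"
proof -
  \<comment> \<open>With the value 0 on \<open>N\<close>, a tag in \<open>N\<close> contributes only
    an increment of \<open>F\<close>, which absolute continuity controls.\<close>
  define g where "g x = (if x \<in> N then 0 else f x)" for x
  have "(g has_integral (F b - F a)) (cbox a b)"
    unfolding has_integral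
  proof (intro allI impI)
    fix e :: real
    assume e: "e > 0"
    \<comment> \<open>The \<open>+ 1\<close> covers \<open>a = b\<close> and makes the total error
      over the interval strictly smaller than \<open>e / 2\<close>.\<close>
    define e1 where "e1 = e / (2 * (b - a + 1))"
    have e1: "e1 > 0"
      using e ab by (simp add: e1_def)
    have "\<exists>d>0. x \<in> {a..b} - N \<longrightarrow>
         (\<forall>y\<in>{a..b}. norm (y-x) < d \<longrightarrow> norm (F y - F x - (y-x) *\<^sub>R f x) \<le> e1 * norm (y-x))" for x
      using deriv[of x] e1 unfolding has_vector_derivative_def has_derivative_within_alt
      by (cases "x \<in> {a..b} - N") (auto intro: exI[of _ 1])
    then obtain d where d: "\<And>x. 0 < d x"
       "\<And>x y. \<lbrakk>x \<in> {a..b} - N; y \<in> {a..b}; norm (y-x) < d x\<rbrakk>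
               \<Longrightarrow> norm (F y - F x - (y-x) *\<^sub>R f x) \<le> e1 * norm (y-x)"
      by metis
    obtain r where r: "r > 0"
      "\<And>S. \<lbrakk>finite S; \<And>u v. (u, v) \<in> S \<Longrightarrow> a \<le> u \<and> u \<le> v \<and> v \<le> b;
           disjoint_family_on (\<lambda>(u, v). {u<..<v}) S; (\<Sum>(u, v)\<in>S. v - u) < r\<rbrakk>
        \<Longrightarrow> (\<Sum>(u, v)\<in>S. cmod (F v - F u)) < e / 2"
      using abs_cont_onD[OF ac, of "e / 2"] e by (metis half_gt_zero)
    \<comment> \<open>Since \<open>N\<close> has measure zero, the whole open cover \<open>G\<close>
      stays below the threshold \<open>r\<close> of absolute continuity.\<close>
    obtain G where G: "open G" "N \<subseteq> G" "G - N \<in> lmeasurable" "emeasure lebesgue (G - N) < ennreal r"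
      using sets_lebesgue_outer_open[OF negligible_imp_sets[OF N] r(1)] by blast
    have GN: "G = (G - N) \<union> N"
      using G(2) by auto
    have Gm: "G \<in> lmeasurable"
      by (subst GN) (intro fmeasurable.Un G(3) negligible_imp_measurable N)
    have "measure lebesgue G \<le> measure lebesgue (G - N) + measure lebesgue N"
      by (subst GN) (intro measure_Un_le fmeasurableD G(3) negligible_imp_measurable N)
    also have "\<dots> < r"
      using G(3,4) r(1) by (simp add: negligible_imp_measure0[OF N] emeasure_eq_measure2 ennreal_less_iff)
    finally have Gr: "measure lebesgue G < r" .
    define \<gamma> where "\<gamma> x = (if x \<in> N then G else ball x (d x))" for x
    show "\<exists>\<gamma>. gauge \<gamma> \<and> (\<forall>p. p tagged_division_of cbox a b \<and> \<gamma> fine p \<longrightarrow>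
            norm ((\<Sum>(x, K)\<in>p. measure lborel K *\<^sub>R g x) - (F b - F a)) < e)"
    proof (intro exI[of _ \<gamma>] conjI allI impI)
      show "gauge \<gamma>"
        using d(1) G by (auto simp: gauge_def \<gamma>_def)
      fix p
      assume "p tagged_division_of cbox a b \<and> \<gamma> fine p"
      then have p: "p tagged_division_of {a..b}" and fine: "\<gamma> fine p"
        by auto
      note pD = tagged_division_ofD[OF p]
      have K: "Inf K \<le> x \<and> x \<le> Sup K \<and> a \<le> Inf K \<and> Sup K \<le> b \<and> K = {Inf K..Sup K}" if xK: "(x, K) \<in> p" for x K
      proof -
        obtain u v where uv: "K = cbox u v"
          using pD(4)[OF xK] by blast
        then show ?thesis
          using pD(2,3)[OF xK] by auto
      qed
      have content_K: "measure lborel K = Sup K - Inf K" if "(x, K) \<in> p" for x K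
        by (metis K[OF that] content_real order_trans)
      define h where "h = (\<lambda>(x, K). measure lborel K *\<^sub>R g x - (F (Sup K) - F (Inf K)))"
      \<comment> \<open>Degenerate intervals are dropped, because \<open>h\<close> vanishes on them.
        The others have nonempty, pairwise disjoint interiors, hence different end points, which
        makes \<open>ends\<close> below injective.\<close>
      define A where "A = {(x, K) \<in> p. x \<in> N \<and> Inf K < Sup K}"
      have "(\<Sum>(x, K)\<in>p. measure lborel K *\<^sub>R g x) - (F b - F a) = sum h p"
        using additive_tagged_division_1[OF ab p, of F]
        by (simp add: h_def sum_subtractf case_prod_unfold)
      also have "\<dots> = sum h {xK \<in> p. fst xK \<notin> N} + sum h {xK \<in> p. fst xK \<in> N}"
        using pD(1) by (subst sum.union_disjoint[symmetric]) (auto intro!: sum.cong)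
      also have "sum h {xK \<in> p. fst xK \<in> N} = sum h A"
      proof (rule sum.mono_neutral_right)
        show "\<forall>i\<in>{xK \<in> p. fst xK \<in> N} - A. h i = 0"
        proof
          fix i assume i: "i \<in> {xK \<in> p. fst xK \<in> N} - A"
          obtain x K where xK: "i = (x, K)" by (cases i)
          have "Inf K = Sup K"
            using i K[of x K] by (auto simp: xK A_def)
          then show "h i = 0"
            using i content_K[of x K] by (simp add: xK h_def)
        qed
      qed (use pD(1) in \<open>auto simp: A_def\<close>)
      finally have split: "(\<Sum>(x, K)\<in>p. measure lborel K *\<^sub>R g x) - (F b - F a) = sum h {xK \<in> p. fst xK \<notin> N} + sum h A" .
      have "norm (sum h {xK \<in> p. fst xK \<notin> N}) \<le> (\<Sum>xK\<in>{xK \<in> p. fst xK \<notin> N}. e1 * measure lborel (snd xK))"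
      proof (rule sum_norm_le)
        fix i assume i: "i \<in> {xK \<in> p. fst xK \<notin> N}"
        obtain x K where xK: "i = (x, K)" by (cases i)
        with i have xp: "(x, K) \<in> p" and xN: "x \<notin> N" by auto
        have x: "x \<in> {a..b} - N"
          using K[OF xp] xN by auto
        have "K \<subseteq> ball x (d x)"
          using fine xp xN unfolding fine_def \<gamma>_def by fastforce
        then have uv: "Inf K \<in> ball x (d x)" "Sup K \<in> ball x (d x)"
          using K[OF xp] by (metis atLeastAtMost_iff order_refl order_trans subset_iff)+
        \<comment> \<open>The tag lies between the two ends, so the two linearisation errors add up
          to \<open>e1\<close> times the length of \<open>K\<close>.\<close>
        have "norm (h i) = norm ((F (Inf K) - F x - (Inf K - x) *\<^sub>R f x) - (F (Sup K) - F x - (Sup K - x) *\<^sub>R f x))"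
          using xN by (simp add: h_def xK g_def content_K[OF xp] algebra_simps)
        also have "\<dots> \<le> norm (F (Inf K) - F x - (Inf K - x) *\<^sub>R f x) + norm (F (Sup K) - F x - (Sup K - x) *\<^sub>R f x)"
          by (rule norm_triangle_ineq4)
        also have "\<dots> \<le> e1 * norm (Inf K - x) + e1 * norm (Sup K - x)"
          using K[OF xp] uv by (intro add_mono d(2)[OF x]) (auto simp: dist_real_def abs_minus_commute)
        also have "\<dots> = e1 * measure lborel K"
          using K[OF xp] by (simp add: content_K[OF xp] algebra_simps)
        finally show "norm (h i) \<le> e1 * measure lborel (snd i)"
          by (simp add: xK)
      qed
      also have "\<dots> \<le> (\<Sum>xK\<in>p. e1 * measure lborel (snd xK))"
        using pD(1) e1 by (intro sum_mono2) auto
      also have "\<dots> = e1 * (b - a)"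
        using additive_content_tagged_division[of p a b] p ab
        by (simp add: sum_distrib_left[symmetric] case_prod_unfold)
      also have "\<dots> < e / 2"
        using ab e by (simp add: e1_def field_simps)
      finally have part1: "norm (sum h {xK \<in> p. fst xK \<notin> N}) < e / 2" .
      define ends where "ends = (\<lambda>(x :: real, K :: real set). (Inf K, Sup K))"
      have disj: "{Inf K<..<Sup K} \<inter> {Inf L<..<Sup L} = {}" if "(x, K) \<in> A" "(y, L) \<in> A" "(x, K) \<noteq> (y, L)" for x K y L
      proof -
        have p: "(x, K) \<in> p" "(y, L) \<in> p"
          using that by (auto simp: A_def)
        have "{Inf K<..<Sup K} = interior K" "{Inf L<..<Sup L} = interior L"
          using K[OF p(1)] K[OF p(2)] by (metis interior_atLeastAtMost_real)+
        with pD(5)[OF p that(3)] show ?thesis by simp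
      qed
      have inj: "inj_on ends A"
      proof (rule inj_onI)
        fix i j assume ij: "i \<in> A" "j \<in> A" "ends i = ends j"
        obtain x K y L where "i = (x, K)" "j = (y, L)" by (cases i, cases j)
        with ij disj[of x K y L] show "i = j"
          by (auto simp: ends_def A_def)
      qed
      have finA: "finite A"
        using pD(1) by (rule finite_subset[rotated]) (auto simp: A_def)
      have disj2: "disjoint_family_on (\<lambda>(u, v). {u<..<v}) (ends ` A)"
        unfolding disjoint_family_on_def
      proof (intro ballI impI)
        fix i j assume "i \<in> ends ` A" "j \<in> ends ` A" and ij: "i \<noteq> j"
        then obtain x K y L where "i = ends (x, K)" "(x, K) \<in> A" "j = ends (y, L)" "(y, L) \<in> A"
          by force
        with ij disj[of x K y L] show "(\<lambda>(u, v). {u<..<v}) i \<inter> (\<lambda>(u, v). {u<..<v}) j = {}"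
          by (auto simp: ends_def)
      qed
      \<comment> \<open>The intervals are disjoint and lie in \<open>G\<close> by fineness, so their
        total length is at most the measure of \<open>G\<close>.\<close>
      have "(\<Sum>(u, v)\<in>ends ` A. v - u) = (\<Sum>i\<in>ends ` A. measure lebesgue ((\<lambda>(u, v). {u<..<v}) i))"
        by (intro sum.cong) (auto simp: ends_def A_def)
      also have "\<dots> = measure lebesgue (\<Union>i\<in>ends ` A. (\<lambda>(u, v). {u<..<v}) i)"
      proof (rule measure_finite_Union[symmetric])
        show "emeasure lebesgue ((\<lambda>(u, v). {u<..<v}) i) \<noteq> \<infinity>" if "i \<in> ends ` A" for i
          using that by (auto simp: ends_def A_def less_imp_le)
      qed (use finA disj2 in \<open>auto simp: case_prod_unfold\<close>)
      also have "\<dots> \<le> measure lebesgue G"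
      proof (rule measure_mono_fmeasurable)
        show "(\<Union>i\<in>ends ` A. (\<lambda>(u, v). {u<..<v}) i) \<subseteq> G"
        proof -
          have "{Inf K<..<Sup K} \<subseteq> G" if "(x, K) \<in> A" for x K
          proof -
            have "(x, K) \<in> p" "x \<in> N"
              using that by (auto simp: A_def)
            then have "K \<subseteq> G"
              using fine unfolding fine_def \<gamma>_def by fastforce
            moreover have "{Inf K<..<Sup K} \<subseteq> K"
              using K[OF \<open>(x, K) \<in> p\<close>] by (metis greaterThanLessThan_subseteq_atLeastAtMost_iff order_refl)
            ultimately show ?thesis by blast
          qed
          then show ?thesis by (auto simp: ends_def subset_iff)
        qed
      
        show "(\<Union>i\<in>ends ` A. (\<lambda>(u, v). {u<..<v}) i) \<in> sets lebesgue"
          using finA by (intro sets.finite_UN) (auto simp: case_prod_unfold)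
      qed (rule Gm)
      also have "\<dots> < r" by (rule Gr)
      finally have small: "(\<Sum>(u, v)\<in>ends ` A. v - u) < r" .
      have "norm (sum h A) \<le> (\<Sum>i\<in>A. (\<lambda>(u, v). cmod (F v - F u)) (ends i))"
      proof (rule sum_norm_le)
        fix i assume "i \<in> A"
        then show "norm (h i) \<le> (\<lambda>(u, v). cmod (F v - F u)) (ends i)"
          by (auto simp: A_def h_def ends_def g_def norm_minus_commute)
      qed
      also have "\<dots> = (\<Sum>(u, v)\<in>ends ` A. cmod (F v - F u))"
        using inj by (simp add: sum.reindex)
      also have "\<dots> < e / 2"
      proof (rule r(2))
        fix u v assume "(u, v) \<in> ends ` A"
        then obtain x K where "(x, K) \<in> A" "u = Inf K" "v = Sup K"
          by (auto simp: ends_def)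
        then show "a \<le> u \<and> u \<le> v \<and> v \<le> b"
          using K[of x K] by (auto simp: A_def)
      qed (use finA disj2 small in auto)
      finally have "norm (sum h A) < e / 2" .
      with part1 show "norm ((\<Sum>(x, K)\<in>p. measure lborel K *\<^sub>R g x) - (F b - F a)) < e"
        unfolding split using norm_triangle_ineq[of "sum h {xK \<in> p. fst xK \<notin> N}" "sum h A"] by linarith
    qed
  qed
  then show ?thesis
    using has_integral_spike[OF N, of "cbox a b" f g] by (auto simp: g_def)
qed

section \<open>Tent functions and weighted integrals\<close>

text \<open>A trapezoid with slopes of size \<open>1 / h\<close>. If \<open>d - c < 2 * h\<close> it
  degenerates to a triangle that stays below 1, so short intervals are covered by the same
  formula.\<close>

definition tent :: "real \<Rightarrow> real \<Rightarrow> real \<Rightarrow> real \<Rightarrow> real" where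
  "tent c d h t = min 1 (min ((t - c) / h) ((d - t) / h))"

text \<open>The derivative of the tent off its possible corners \<open>c + h\<close>,
  \<open>d - h\<close> and \<open>(c + d) / 2\<close>; the values at these three points are a
  convention.\<close>

definition tent' :: "real \<Rightarrow> real \<Rightarrow> real \<Rightarrow> real \<Rightarrow> real" where
  "tent' c d h t = (if t - c < h \<and> t - c < d - t then 1 / h
     else if d - t < h \<and> d - t < t - c then - (1 / h) else 0)"

lemma tent_endpoints [simp]:
  assumes "c \<le> d" "h > 0"
  shows "tent c d h c = 0" "tent c d h d = 0"
proof -
  have "(d - c) / h \<ge> 0"
    using assms by simp
  then show "tent c d h c = 0" "tent c d h d = 0"
    by (simp_all add: tent_def)
qed

lemma tent_bounds:
  assumes "h > 0" "t \<in> {c..d}"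
  shows "0 \<le> tent c d h t" "tent c d h t \<le> 1"
  using assms by (auto simp: tent_def)

lemma abs_tent'_le: "h > 0 \<Longrightarrow> \<bar>tent' c d h t\<bar> \<le> 1 / h"
  by (auto simp: tent'_def)

lemma lipschitz_on_tent:
  assumes "h > 0"
  shows "(1 / h)-lipschitz_on U (tent c d h)"
proof (rule lipschitz_onI)
  fix x y
  have "\<bar>(x - c) / h - (y - c) / h\<bar> = \<bar>x - y\<bar> / h" "\<bar>(d - x) / h - (d - y) / h\<bar> = \<bar>x - y\<bar> / h"
    using assms by (auto simp: diff_divide_distrib[symmetric] abs_minus_commute)
  then show "dist (tent c d h x) (tent c d h y) \<le> 1 / h * dist x y"
    unfolding tent_def dist_real_def by (simp add: min_def) linarith
qed (use assms in auto)

text \<open>Two branches of the minimum can meet only at the three excluded points, so near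
  \<open>t\<close> a single branch is the minimum.\<close>

lemma tent_has_derivative:
  assumes h: "h > 0" and t: "t \<notin> {c + h, d - h, (c + d) / 2}"
  shows "(tent c d h has_real_derivative tent' c d h t) (at t)"
proof -
  consider "t - c < h \<and> t - c < d - t" | "d - t < h \<and> d - t < t - c" | "h < t - c \<and> h < d - t"
    using t by fastforce
  then show ?thesis
  proof cases
    case 1
    have "((\<lambda>t. (t - c) / h) has_real_derivative 1 / h) (at t)"
      using h by (auto intro!: derivative_eq_intros)
    then have "(tent c d h has_real_derivative 1 / h) (at t)"
    proof (rule has_field_derivative_transform_within_open)
      show "open ({..<c + h} \<inter> {..<(c + d) / 2})" by auto
      show "t \<in> {..<c + h} \<inter> {..<(c + d) / 2}" using 1 by (auto simp: field_simps)
      fix x assume "x \<in> {..<c + h} \<inter> {..<(c + d) / 2}"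
      then have "x - c \<le> h" "x - c \<le> d - x"
        by (auto simp: field_simps)
      then have "(x - c) / h \<le> 1" "(x - c) / h \<le> (d - x) / h"
        using h by (auto intro: divide_right_mono)
      then show "(x - c) / h = tent c d h x" by (simp add: tent_def)
    qed
    with 1 show ?thesis by (simp add: tent'_def)
  next
    case 2
    have "((\<lambda>t. (d - t) / h) has_real_derivative - (1 / h)) (at t)"
      using h by (auto intro!: derivative_eq_intros)
    then have "(tent c d h has_real_derivative - (1 / h)) (at t)"
    proof (rule has_field_derivative_transform_within_open)
      show "open ({d - h<..} \<inter> {(c + d) / 2<..})" by auto
      show "t \<in> {d - h<..} \<inter> {(c + d) / 2<..}" using 2 by (auto simp: field_simps)
      fix x assume "x \<in> {d - h<..} \<inter> {(c + d) / 2<..}"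
      then have "d - x \<le> h" "d - x \<le> x - c"
        by (auto simp: field_simps)
      then have "(d - x) / h \<le> 1" "(d - x) / h \<le> (x - c) / h"
        using h by (auto intro: divide_right_mono)
      then show "(d - x) / h = tent c d h x" by (simp add: tent_def)
    qed
    with 2 show ?thesis by (simp add: tent'_def)
  next
    case 3
    have "((\<lambda>t. 1) has_real_derivative 0) (at t)"
      by simp
    then have "(tent c d h has_real_derivative 0) (at t)"
    proof (rule has_field_derivative_transform_within_open)
      show "open {c + h<..<d - h}" by auto
      show "t \<in> {c + h<..<d - h}" using 3 by auto
      fix x assume "x \<in> {c + h<..<d - h}"
      then have "1 \<le> (x - c) / h" "1 \<le> (d - x) / h"
        using h by (auto simp: field_simps)
      then show "1 = tent c d h x" by (simp add: tent_def)
    qed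
    with 3 show ?thesis by (simp add: tent'_def)
  qed
qed

lemma continuous_on_tent: "h > 0 \<Longrightarrow> continuous_on U (tent c d h)"
  using lipschitz_on_tent by (rule lipschitz_on_continuous_on)

text \<open>An explicit primitive of the ramp by which the tent falls short of 1 near one end
  point.\<close>

lemma ramp_antiderivative:
  fixes h :: real
  assumes h: "h > 0" and u: "u \<noteq> h"
  shows "((\<lambda>u. - (h / 2) * (max 0 (1 - u / h))\<^sup>2) has_real_derivative max 0 (1 - u / h)) (at u)"
proof (cases "u < h")
  case True
  have "((\<lambda>u. - (h / 2) * (1 - u / h)\<^sup>2) has_real_derivative 1 - u / h) (at u)"
    using h by (auto intro!: derivative_eq_intros simp: field_simps power2_eq_square)
  then have "((\<lambda>u. - (h / 2) * (max 0 (1 - u / h))\<^sup>2) has_real_derivative 1 - u / h) (at u)"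
    by (rule has_field_derivative_transform_within_open[of _ _ _ "{..<h}"])
      (use True h in \<open>auto simp: max_def field_simps\<close>)
  moreover have "max 0 (1 - u / h) = 1 - u / h"
    using True h by (simp add: max_def field_simps)
  ultimately show ?thesis by simp
next
  case False
  then have "h < u" using u by auto
  have "((\<lambda>u. 0) has_real_derivative 0) (at u)"
    by simp
  then have "((\<lambda>u. - (h / 2) * (max 0 (1 - u / h))\<^sup>2) has_real_derivative 0) (at u)"
    by (rule has_field_derivative_transform_within_open[of _ _ _ "{h<..}"])
      (use \<open>h < u\<close> h in \<open>auto simp: max_def field_simps\<close>)
  moreover have "max 0 (1 - u / h) = 0"
    using \<open>h < u\<close> h by (simp add: max_def field_simps)
  ultimately show ?thesis by simp
qed

text \<open>The defect of the tent is the maximum of 0 and two terms, hence at most the sum of the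
  two ramps starting at \<open>c\<close> and at \<open>d\<close>. Each ramp has integral at most
  \<open>h / 2\<close>.\<close>

lemma integral_one_minus_tent_le:
  assumes cd: "c \<le> d" and h: "h > 0"
  shows "integral {c..d} (\<lambda>t. 1 - tent c d h t) \<le> h"
proof -
  define R r where "R = (\<lambda>u. - (h / 2) * (max 0 (1 - u / h))\<^sup>2)" and "r = (\<lambda>u. max 0 (1 - u / h))"
  have R: "(R has_real_derivative r u) (at u)" if "u \<noteq> h" for u
    using ramp_antiderivative[OF h that] by (simp add: R_def r_def)
  have R_cont: "continuous_on UNIV R"
    unfolding R_def using h by (intro continuous_intros) auto
  have R_bounds: "- (h / 2) \<le> R u" "R u \<le> 0" if "u \<ge> 0" for u
  proof -
    have "(max 0 (1 - u / h))\<^sup>2 \<le> 1"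
      using that h by (intro power_le_one) auto
    then show "- (h / 2) \<le> R u" "R u \<le> 0"
      using h by (auto simp: R_def)
  qed
  define F where "F t = R (t - c) - R (d - t)" for t
  have I: "((\<lambda>t. r (t - c) + r (d - t)) has_integral (F d - F c)) {c..d}"
  proof (rule fundamental_theorem_of_calculus_interior_strong[of "{c + h, d - h}"])
    show "continuous_on {c..d} F"
      unfolding F_def
      by (intro continuous_on_diff continuous_on_compose2[OF R_cont] continuous_intros) auto
    fix t assume t: "t \<in> {c<..<d} - {c + h, d - h}"
    have "((\<lambda>t. R (t - c)) has_real_derivative r (t - c) * 1) (at t)"
      by (rule DERIV_chain'[of "\<lambda>t. t - c" 1 t UNIV R]) (use t in \<open>auto intro!: derivative_eq_intros R\<close>)
    moreover have "((\<lambda>t. R (d - t)) has_real_derivative r (d - t) * (- 1)) (at t)"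
      by (rule DERIV_chain'[of "\<lambda>t. d - t" "-1" t UNIV R]) (use t in \<open>auto intro!: derivative_eq_intros R\<close>)
    ultimately have "(F has_real_derivative r (t - c) * 1 - r (d - t) * (- 1)) (at t)"
      unfolding F_def by (rule DERIV_diff)
    then show "(F has_vector_derivative r (t - c) + r (d - t)) (at t)"
      by (simp add: has_real_derivative_iff_has_vector_derivative)
  qed (use cd in auto)
  have "integral {c..d} (\<lambda>t. 1 - tent c d h t) \<le> integral {c..d} (\<lambda>t. r (t - c) + r (d - t))"
  proof (rule integral_le)
    show "(\<lambda>t. 1 - tent c d h t) integrable_on {c..d}"
      by (intro integrable_continuous_real continuous_intros continuous_on_tent h)
    fix t
    show "1 - tent c d h t \<le> r (t - c) + r (d - t)"
      by (simp add: tent_def r_def min_def max_def)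
  qed (use I in auto)
  also have "\<dots> = F d - F c"
    using I by (simp add: has_integral_iff)
  also have "\<dots> \<le> h"
    using R_bounds[of 0] R_bounds[of "d - c"] cd by (simp add: F_def)
  finally show ?thesis .
qed

section \<open>Additivity over consecutive intervals and integrability of products\<close>

lemma sum_integral_consecutive:
  fixes F :: "real \<Rightarrow> real"
  assumes "\<And>k. k \<le> n \<Longrightarrow> x k \<le> x (Suc k)" "F integrable_on {x 0..x (Suc n)}"
  shows "(\<Sum>k\<le>n. integral {x k..x (Suc k)} F) = integral {x 0..x (Suc n)} F"
  using assms
proof (induction n)
  case 0
  then show ?case by simp
next
  case (Suc n)
  have mono: "x 0 \<le> x k" if "k \<le> Suc n" for k
    using that
  proof (induction k)
    case (Suc k)
    then show ?case
      using \<open>\<And>k. k \<le> Suc n \<Longrightarrow> x k \<le> x (Suc k)\<close>[of k] by linarith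
  qed simp
  have le: "x 0 \<le> x (Suc n)" "x (Suc n) \<le> x (Suc (Suc n))"
    using mono[of "Suc n"] Suc.prems(1)[of "Suc n"] by simp_all
  have "F integrable_on {x 0..x (Suc n)}"
    using le by (intro integrable_on_subinterval[OF Suc.prems(2)]) auto
  then have "(\<Sum>k\<le>n. integral {x k..x (Suc k)} F) = integral {x 0..x (Suc n)} F"
    using Suc.prems(1) by (intro Suc.IH) simp_all
  then show ?case
    using Henstock_Kurzweil_Integration.integral_combine[OF le Suc.prems(2)] by simp
qed

lemma absolutely_integrable_mult_continuous:
  fixes q h :: "real \<Rightarrow> real"
  assumes q: "q absolutely_integrable_on {a..b}" and h: "continuous_on {a..b} h"
  shows "(\<lambda>x. q x * h x) absolutely_integrable_on {a..b}"
proof -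
  obtain C where C: "\<And>x. x \<in> {a..b} \<Longrightarrow> \<bar>h x\<bar> \<le> C"
    using compact_imp_bounded[OF compact_continuous_image[OF h]] unfolding bounded_iff by fastforce
  have q': "integrable lebesgue (\<lambda>x. indicator {a..b} x *\<^sub>R q x)"
    using q by (simp add: set_integrable_def)
  have h': "integrable lebesgue (\<lambda>x. indicator {a..b} x *\<^sub>R h x)"
    using absolutely_integrable_continuous_real[OF h] by (simp add: set_integrable_def)
  have "integrable lebesgue (\<lambda>x. (indicator {a..b} x *\<^sub>R q x) * (indicator {a..b} x *\<^sub>R h x))"
  proof (rule Bochner_Integration.integrable_bound)
    show "integrable lebesgue (\<lambda>x. C * (indicator {a..b} x *\<^sub>R q x))"
      using q' by (rule integrable_mult_right)
    have "norm ((indicator {a..b} x *\<^sub>R q x) * (indicator {a..b} x *\<^sub>R h x))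
        \<le> norm (C * (indicator {a..b} x *\<^sub>R q x))" for x
      using C[of x] by (auto simp: indicator_def abs_mult mult.commute[of "\<bar>q x\<bar>"] intro!: mult_right_mono)
    then show "AE x in lebesgue. norm ((indicator {a..b} x *\<^sub>R q x) * (indicator {a..b} x *\<^sub>R h x))
        \<le> norm (C * (indicator {a..b} x *\<^sub>R q x))"
      by simp
  qed (use q' h' in auto)
  moreover have "(\<lambda>x. (indicator {a..b} x *\<^sub>R q x) * (indicator {a..b} x *\<^sub>R h x)) = (\<lambda>x. indicator {a..b} x *\<^sub>R (q x * h x))"
    by (auto simp: indicator_def)
  ultimately show ?thesis
    unfolding set_integrable_def by metis
qed

lemma abs_integral_mono:
  fixes f g :: "real \<Rightarrow> real"
  assumes "f integrable_on S" "g integrable_on S" "\<And>x. x \<in> S \<Longrightarrow> \<bar>f x\<bar> \<le> g x"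
  shows "\<bar>integral S f\<bar> \<le> integral S g"
  using Henstock_Kurzweil_Integration.integral_norm_bound_integral[OF assms(1,2)] assms(3) by simp

section \<open>Eigenfunctions for a nonreal eigenvalue\<close>

text \<open>The boundary term in the integration by parts that pairs the equation with
  \<open>f\<close>.\<close>

definition bracket :: "(real \<Rightarrow> complex) \<Rightarrow> (real \<Rightarrow> complex) \<Rightarrow> real \<Rightarrow> complex" where
  "bracket f f' x = f' x * cnj (f x)"

text \<open>The boundary conditions enter only through the last two assumptions: the boundary term
  is real, and its size from above is controlled by \<open>\<kappa>\<close>. Separated and coupled
  conditions are thus treated together.\<close>

locale indefinite_eigenfunction =
  fixes a b :: real and q w :: "real \<Rightarrow> real" and lam :: complex
    and f f' :: "real \<Rightarrow> complex" and \<kappa> :: real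
  assumes ab: "a < b"
    and q_int: "q absolutely_integrable_on {a..b}"
    and w_int: "w absolutely_integrable_on {a..b}"
    and f_deriv: "\<And>x. x \<in> {a..b} \<Longrightarrow> (f has_vector_derivative f' x) (at x within {a..b})"
    and f_ac: "abs_cont_on a b f"
    and f'_ac: "abs_cont_on a b f'"
    and ode: "\<exists>N. negligible N \<and> (\<forall>x\<in>{a..b} - N.
      (f' has_vector_derivative (of_real (q x) - lam * of_real (w x)) * f x) (at x within {a..b}))"
    and nonzero: "\<exists>x\<in>{a..b}. f x \<noteq> 0"
    and nonreal: "Im lam \<noteq> 0"
    and kappa_nonneg: "\<kappa> \<ge> 0"
    and boundary_real: "Im (bracket f f' b - bracket f f' a) = 0"
    and boundary_le: "\<And>S. \<lbrakk>(cmod (f a))\<^sup>2 \<le> S; (cmod (f b))\<^sup>2 \<le> S\<rbrakk>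
      \<Longrightarrow> Re (bracket f f' b - bracket f f' a) \<le> \<kappa> * S"
begin

lemma f_cont: "continuous_on {a..b} f"
  using f_ac by (rule abs_cont_on_imp_continuous_on)

lemma f'_cont: "continuous_on {a..b} f'"
  using f'_ac by (rule abs_cont_on_imp_continuous_on)

definition m :: "real \<Rightarrow> real" where "m x = (cmod (f x))\<^sup>2"
definition m' :: "real \<Rightarrow> real" where "m' x = (cmod (f' x))\<^sup>2"
text \<open>This product is the modulus of \<open>bracket f f'\<close> and dominates half the
  derivative of \<open>m\<close>; it replaces both in the estimates.\<close>

definition mm :: "real \<Rightarrow> real" where "mm x = cmod (f' x) * cmod (f x)"

text \<open>The fundamental theorem for \<open>g * bracket f f'\<close>, with the second derivative
  of \<open>f\<close> replaced by means of the equation. A Lipschitz \<open>g\<close> keeps the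
  product absolutely continuous, and \<open>Z\<close> absorbs its corners. The choice
  \<open>g = 1\<close> gives the global energy identity, a tent the local one.\<close>

lemma weighted_identity:
  assumes cd: "a \<le> c" "c \<le> d" "d \<le> b"
    and g_lip: "C-lipschitz_on {c..d} g" and Z: "negligible Z"
    and g_deriv: "\<And>x. x \<in> {c..d} - Z \<Longrightarrow> (g has_real_derivative g' x) (at x within {c..d})"
  shows "((\<lambda>x. of_real (g' x) * bracket f f' x + of_real (g x * (m' x + q x * m x))
        - lam * of_real (w x * (g x * m x)))
      has_integral (of_real (g d) * bracket f f' d - of_real (g c) * bracket f f' c)) {c..d}"
proof -
  obtain N where N: "negligible N" "\<And>x. x \<in> {a..b} - N \<Longrightarrow>
      (f' has_vector_derivative (of_real (q x) - lam * of_real (w x)) * f x) (at x within {a..b})"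
    using ode by blast
  have sub: "{c..d} \<subseteq> {a..b}"
    using cd by auto
  have br: "bracket f f' = (\<lambda>x. f' x * cnj (f x))"
    by (auto simp: bracket_def)
  have "abs_cont_on c d (\<lambda>x. complex_of_real (g x))"
    using g_lip by (intro abs_cont_on_lipschitz[of C]) (auto simp: lipschitz_on_def dist_of_real)
  then have ac: "abs_cont_on c d (\<lambda>x. of_real (g x) * bracket f f' x)"
    unfolding br using cd
    by (intro abs_cont_on_mult abs_cont_on_cnj abs_cont_on_subset[OF f_ac] abs_cont_on_subset[OF f'_ac])
  show ?thesis
  proof (rule abs_cont_on_fundamental_theorem[OF cd(2) ac])
    show "negligible (N \<union> Z)"
      using N(1) Z by simp
    fix x assume x: "x \<in> {c..d} - (N \<union> Z)"
    then have xab: "x \<in> {a..b}" "x \<in> {a..b} - N" "x \<in> {c..d} - Z"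
      using sub by auto
    have 1: "(f' has_vector_derivative (of_real (q x) - lam * of_real (w x)) * f x) (at x within {c..d})"
      by (rule has_vector_derivative_within_subset[OF N(2)[OF xab(2)] sub])
    have 2: "((\<lambda>x. cnj (f x)) has_vector_derivative cnj (f' x)) (at x within {c..d})"
      using bounded_linear.has_vector_derivative[OF bounded_linear_cnj
          has_vector_derivative_within_subset[OF f_deriv[OF xab(1)] sub]] .
    have 3: "((\<lambda>x. complex_of_real (g x)) has_vector_derivative complex_of_real (g' x)) (at x within {c..d})"
      using has_vector_derivative_of_real[OF g_deriv[OF xab(3)]] .
    have "((\<lambda>x. of_real (g x) * (f' x * cnj (f x))) has_vector_derivative
        of_real (g x) * (f' x * cnj (f' x) + (of_real (q x) - lam * of_real (w x)) * f x * cnj (f x))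
        + of_real (g' x) * (f' x * cnj (f x))) (at x within {c..d})"
      by (rule has_vector_derivative_mult[OF 3 has_vector_derivative_mult[OF 1 2]])
    moreover have "of_real (g x) * (f' x * cnj (f' x) + (of_real (q x) - lam * of_real (w x)) * f x * cnj (f x))
        + of_real (g' x) * (f' x * cnj (f x))
      = of_real (g' x) * (f' x * cnj (f x)) + of_real (g x * (m' x + q x * m x)) - lam * of_real (w x * (g x * m x))"
      by (simp only: m_def m'_def of_real_mult of_real_add complex_norm_square) (simp add: algebra_simps)
    ultimately show "((\<lambda>x. of_real (g x) * bracket f f' x) has_vector_derivative
        of_real (g' x) * bracket f f' x + of_real (g x * (m' x + q x * m x)) - lam * of_real (w x * (g x * m x)))
        (at x within {c..d})"
      unfolding br by simp
  qed
qed

section \<open>Global energy estimates\<close>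

lemma continuous_m:
  assumes "S \<subseteq> {a..b}"
  shows "continuous_on S m" "continuous_on S m'" "continuous_on S mm"
  using continuous_on_subset[OF f_cont assms] continuous_on_subset[OF f'_cont assms]
  unfolding m_def m'_def mm_def by (auto intro!: continuous_intros)

lemma m_nonneg [simp]: "0 \<le> m x" "0 \<le> m' x" "0 \<le> mm x"
  by (simp_all add: m_def m'_def mm_def)

lemma integrable_m:
  assumes "a \<le> c" "d \<le> b"
  shows "m integrable_on {c..d}" "m' integrable_on {c..d}" "mm integrable_on {c..d}"
  using assms by (auto intro!: integrable_continuous_real continuous_m)

lemma integrable_weight:
  fixes v h :: "real \<Rightarrow> real"
  assumes "v absolutely_integrable_on {a..b}" "a \<le> c" "d \<le> b" "continuous_on {c..d} h"
  shows "(\<lambda>x. v x * h x) integrable_on {c..d}" "(\<lambda>x. \<bar>v x\<bar> * h x) integrable_on {c..d}"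
proof -
  have v: "v absolutely_integrable_on {c..d}"
    using assms by (intro absolutely_integrable_on_subinterval[OF assms(1)]) auto
  then have "(\<lambda>x. \<bar>v x\<bar>) absolutely_integrable_on {c..d}"
    using absolutely_integrable_norm[OF v] by (simp add: o_def)
  then show "(\<lambda>x. \<bar>v x\<bar> * h x) integrable_on {c..d}"
    by (rule set_lebesgue_integral_eq_integral(1)[OF absolutely_integrable_mult_continuous[OF _ assms(4)]])
  show "(\<lambda>x. v x * h x) integrable_on {c..d}"
    by (rule set_lebesgue_integral_eq_integral(1)[OF absolutely_integrable_mult_continuous[OF v assms(4)]])
qed

text \<open>In the identity with weight 1 everything but the \<open>lam\<close> term is real. The
  imaginary part therefore kills the integral of \<open>w * m\<close>, which in turn removes
  \<open>lam\<close> from the real part.\<close>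

lemma energy_identity:
  "integral {a..b} (\<lambda>x. w x * m x) = 0"
  "integral {a..b} m' + integral {a..b} (\<lambda>x. q x * m x) = Re (bracket f f' b - bracket f f' a)"
proof -
  have I: "((\<lambda>x. of_real (m' x + q x * m x) - lam * of_real (w x * m x))
      has_integral (bracket f f' b - bracket f f' a)) {a..b}"
    using weighted_identity[of a b 0 "\<lambda>_. 1" "{}" "\<lambda>_. 0"] ab by (simp add: lipschitz_on_def)
  have W: "(\<lambda>x. w x * m x) integrable_on {a..b}" and Q: "(\<lambda>x. q x * m x) integrable_on {a..b}"
    using integrable_weight(1)[OF w_int order_refl order_refl continuous_m(1)[OF order_refl]]
      integrable_weight(1)[OF q_int order_refl order_refl continuous_m(1)[OF order_refl]] by auto
  have "((\<lambda>x. Im (of_real (m' x + q x * m x) - lam * of_real (w x * m x)))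
      has_integral Im (bracket f f' b - bracket f f' a)) {a..b}"
    using has_integral_linear[OF I bounded_linear_Im] by (simp add: o_def)
  then have "((\<lambda>x. - Im lam * (w x * m x)) has_integral 0) {a..b}"
    using boundary_real by simp
  \<comment> \<open>The same integral has the values 0 and \<open>- Im lam\<close> times the
    integral of \<open>w * m\<close>, and \<open>Im lam\<close> is nonzero.\<close>
  from has_integral_unique[OF this, of "- Im lam * integral {a..b} (\<lambda>x. w x * m x)"]
  have "((\<lambda>x. - Im lam * (w x * m x)) has_integral - Im lam * integral {a..b} (\<lambda>x. w x * m x)) {a..b}
    \<Longrightarrow> integral {a..b} (\<lambda>x. w x * m x) = 0"
    using nonreal by simp
  then show wm: "integral {a..b} (\<lambda>x. w x * m x) = 0"
    using has_integral_mult_right[OF integrable_integral[OF W]] by blast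
  have "((\<lambda>x. Re (of_real (m' x + q x * m x) - lam * of_real (w x * m x)))
      has_integral Re (bracket f f' b - bracket f f' a)) {a..b}"
    using has_integral_linear[OF I bounded_linear_Re] by (simp add: o_def)
  then have "((\<lambda>x. m' x + q x * m x - Re lam * (w x * m x))
      has_integral Re (bracket f f' b - bracket f f' a)) {a..b}"
    by simp
  note has_integral_unique[OF this]
  moreover have "((\<lambda>x. m' x + q x * m x - Re lam * (w x * m x))
      has_integral integral {a..b} m' + integral {a..b} (\<lambda>x. q x * m x) - Re lam * 0) {a..b}"
    using integrable_integral[OF W] integrable_integral[OF Q]
      integrable_integral[OF integrable_m(2)[OF order_refl order_refl]] unfolding wm
    by (intro has_integral_diff has_integral_add has_integral_mult_right)
  ultimately show "integral {a..b} m' + integral {a..b} (\<lambda>x. q x * m x) = Re (bracket f f' b - bracket f f' a)"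
    by fastforce
qed

text \<open>The derivative of |f|^2 is 2 Re (f' cnj f), which is at most \<open>2 * mm\<close> in
  modulus.\<close>

lemma m_difference_le:
  assumes "x \<in> {a..b}" "t \<in> {a..b}"
  shows "\<bar>m x - m t\<bar> \<le> 2 * integral {a..b} mm"
proof -
  have *: "\<bar>m v - m u\<bar> \<le> 2 * integral {a..b} mm" if uv: "a \<le> u" "u \<le> v" "v \<le> b" for u v
  proof -
    have I: "((\<lambda>x. 2 * Re (f' x * cnj (f x))) has_integral (m v - m u)) {u..v}"
    proof (rule fundamental_theorem_of_calculus[OF uv(2)])
      fix y assume "y \<in> {u..v}"
      then have y: "y \<in> {a..b}" "{u..v} \<subseteq> {a..b}"
        using uv by auto
      have d: "(f has_vector_derivative f' y) (at y within {u..v})"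
        by (rule has_vector_derivative_within_subset[OF f_deriv[OF y(1)] y(2)])
      have "((\<lambda>x. f x * cnj (f x)) has_vector_derivative f y * cnj (f' y) + f' y * cnj (f y)) (at y within {u..v})"
        by (rule has_vector_derivative_mult[OF d bounded_linear.has_vector_derivative[OF bounded_linear_cnj d]])
      then have "((\<lambda>x. Re (f x * cnj (f x))) has_vector_derivative Re (f y * cnj (f' y) + f' y * cnj (f y))) (at y within {u..v})"
        by (rule bounded_linear.has_vector_derivative[OF bounded_linear_Re])
      moreover have "(\<lambda>x. Re (f x * cnj (f x))) = m"
        by (auto simp: m_def complex_mult_cnj cmod_power2)
      ultimately show "(m has_vector_derivative 2 * Re (f' y * cnj (f y))) (at y within {u..v})"
        by (simp add: algebra_simps)
    qed
    have "\<bar>m v - m u\<bar> = \<bar>integral {u..v} (\<lambda>x. 2 * Re (f' x * cnj (f x)))\<bar>"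
      using I by (simp add: has_integral_iff)
    also have "\<dots> \<le> integral {u..v} (\<lambda>x. 2 * mm x)"
    proof (rule abs_integral_mono)
      show "(\<lambda>x. 2 * mm x) integrable_on {u..v}"
        using uv by (intro integrable_on_mult_right integrable_m)
      fix y
      show "\<bar>2 * Re (f' y * cnj (f y))\<bar> \<le> 2 * mm y"
        using abs_Re_le_cmod[of "f' y * cnj (f y)"] by (simp add: mm_def norm_mult)
    qed (use I in auto)
    also have "\<dots> = 2 * integral {u..v} mm"
      by simp
    also have "\<dots> \<le> 2 * integral {a..b} mm"
      using uv by (intro mult_left_mono integral_subset_le integrable_m) auto
    finally show ?thesis .
  qed
  show ?thesis
    using *[of x t] *[of t x] assms by (cases "x \<le> t") (auto simp: abs_minus_commute)
qed

text \<open>AM-GM with a free parameter \<open>r\<close> takes the place of the Cauchy-Schwarz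
  inequality; each later use picks a suitable \<open>r\<close>.\<close>

lemma two_mm_le:
  assumes "r > 0"
  shows "2 * integral {a..b} mm \<le> r * integral {a..b} m + integral {a..b} m' / r"
proof -
  have "integral {a..b} (\<lambda>x. 2 * mm x) \<le> integral {a..b} (\<lambda>x. r * m x + m' x / r)"
  proof (rule integral_le)
    show "(\<lambda>x. 2 * mm x) integrable_on {a..b}"
      by (intro integrable_on_mult_right integrable_m) auto
    show "(\<lambda>x. r * m x + m' x / r) integrable_on {a..b}"
      by (intro integrable_continuous_real continuous_intros continuous_m) (use assms in auto)
    fix x
    have "0 \<le> (r * cmod (f x) - cmod (f' x))\<^sup>2 / r"
      using assms by simp
    also have "\<dots> = r * m x + m' x / r - 2 * mm x"
      using assms by (simp add: m_def m'_def mm_def power2_eq_square field_simps)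
    finally show "2 * mm x \<le> r * m x + m' x / r"
      by simp
  qed
  also have "\<dots> = r * integral {a..b} m + integral {a..b} m' / r"
    by (subst Henstock_Kurzweil_Integration.integral_add)
      (auto intro!: integrable_on_mult_right integrable_on_divide integrable_m)
  finally show ?thesis
    by simp
qed

text \<open>In the energy identity only the negative part of \<open>q\<close> and the boundary term
  can make the integral of \<open>m'\<close> large, and both are bounded by multiples of
  \<open>S\<close>.\<close>

lemma dirichlet_integral_le:
  assumes "\<And>x. x \<in> {a..b} \<Longrightarrow> m x \<le> S"
  shows "integral {a..b} m' \<le> (\<kappa> + integral {a..b} (\<lambda>x. \<bar>min 0 (q x)\<bar>)) * S"
proof -
  \<comment> \<open>This form reduces integrability of the negative part to
    \<open>integrable_weight\<close> with the constant factor 1.\<close>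
  have neg: "\<bar>min 0 (q x)\<bar> = (\<bar>q x\<bar> * 1 - q x * 1) / 2" for x
    by (simp add: min_def)
  have neg_int: "(\<lambda>x. \<bar>min 0 (q x)\<bar>) integrable_on {a..b}"
    unfolding neg by (intro integrable_on_divide integrable_diff integrable_weight[OF q_int] continuous_on_const) auto
  have "integral {a..b} (\<lambda>x. - (q x * m x)) \<le> integral {a..b} (\<lambda>x. \<bar>min 0 (q x)\<bar> * S)"
  proof (rule integral_le)
    show "(\<lambda>x. - (q x * m x)) integrable_on {a..b}"
      using integrable_weight(1)[OF q_int order_refl order_refl continuous_m(1)[OF order_refl]]
      by (rule integrable_neg)
    show "(\<lambda>x. \<bar>min 0 (q x)\<bar> * S) integrable_on {a..b}"
      using neg_int by (rule integrable_on_mult_left)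
    fix x assume "x \<in> {a..b}"
    then have "m x \<le> S" by (rule assms)
    have "- (q x * m x) \<le> \<bar>min 0 (q x)\<bar> * m x"
      by (cases "q x \<le> 0") (auto simp: min_def)
    also have "\<dots> \<le> \<bar>min 0 (q x)\<bar> * S"
      using \<open>m x \<le> S\<close> by (intro mult_left_mono) auto
    finally show "- (q x * m x) \<le> \<bar>min 0 (q x)\<bar> * S" .
  qed
  moreover have "Re (bracket f f' b - bracket f f' a) \<le> \<kappa> * S"
    using assms[of a] assms[of b] ab by (intro boundary_le) (auto simp: m_def)
  ultimately show ?thesis
    using energy_identity(2) by (simp add: algebra_simps)
qed

text \<open>The vanishing of the integral of \<open>w * m\<close> turns the bound on the oscillation
  of \<open>m\<close> into a bound on its size.\<close>

lemma sup_le: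
  assumes x: "x \<in> {a..b}"
  shows "m x * \<bar>integral {a..b} w\<bar> \<le> integral {a..b} (\<lambda>t. \<bar>w t\<bar>) * (2 * integral {a..b} mm)"
proof -
  have W: "(\<lambda>t. w t * m t) integrable_on {a..b}" and W1: "(\<lambda>t. m x * w t) integrable_on {a..b}"
    and W2: "(\<lambda>t. \<bar>w t\<bar> * (2 * integral {a..b} mm)) integrable_on {a..b}"
    using integrable_weight[OF w_int order_refl order_refl continuous_m(1)[OF order_refl]]
      integrable_weight[OF w_int order_refl order_refl continuous_on_const[of _ "m x"]]
      integrable_weight[OF w_int order_refl order_refl continuous_on_const[of _ "2 * integral {a..b} mm"]]
    by (auto simp: mult.commute)
  have "m x * integral {a..b} w = integral {a..b} (\<lambda>t. m x * w t - w t * m t)"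
    using energy_identity(1) by (simp add: Henstock_Kurzweil_Integration.integral_diff[OF W1 W])
  then have "m x * \<bar>integral {a..b} w\<bar> = \<bar>integral {a..b} (\<lambda>t. m x * w t - w t * m t)\<bar>"
    by (metis abs_mult abs_of_nonneg m_nonneg(1))
  also have "\<dots> \<le> integral {a..b} (\<lambda>t. \<bar>w t\<bar> * (2 * integral {a..b} mm))"
  proof (rule abs_integral_mono)
    show "(\<lambda>t. m x * w t - w t * m t) integrable_on {a..b}"
      by (rule integrable_diff[OF W1 W])
    fix t assume t: "t \<in> {a..b}"
    have "\<bar>m x * w t - w t * m t\<bar> = \<bar>w t\<bar> * \<bar>m x - m t\<bar>"
      by (simp add: abs_mult[symmetric] algebra_simps)
    also have "\<dots> \<le> \<bar>w t\<bar> * (2 * integral {a..b} mm)"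
      by (intro mult_left_mono m_difference_le x t) auto
    finally show "\<bar>m x * w t - w t * m t\<bar> \<le> \<bar>w t\<bar> * (2 * integral {a..b} mm)" .
  qed (rule W2)
  also have "\<dots> = integral {a..b} (\<lambda>t. \<bar>w t\<bar>) * (2 * integral {a..b} mm)"
    by simp
  finally show ?thesis .
qed

text \<open>With \<open>S\<close> the maximum of \<open>m\<close>, the three inequalities
  \<open>D \<le> \<alpha> * S\<close>, \<open>S \<le> K * (2 * Q)\<close> and
  \<open>2 * Q \<le> r * N + D / r\<close> form a closed system. A good \<open>r\<close> lets part
  of \<open>S\<close> be absorbed on the left.\<close>

lemma a_priori_bounds:
  assumes W: "integral {a..b} w \<noteq> 0"
    and \<alpha>: "\<alpha> = \<kappa> + integral {a..b} (\<lambda>x. \<bar>min 0 (q x)\<bar>)"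
    and \<delta>: "\<delta> = 2 + 2 * (integral {a..b} (\<lambda>t. \<bar>w t\<bar>) / \<bar>integral {a..b} w\<bar>)"
  shows "\<alpha> > 0" "\<delta> > 0" "integral {a..b} m > 0"
    "\<And>x. x \<in> {a..b} \<Longrightarrow> m x \<le> \<alpha> * \<delta>\<^sup>2 * integral {a..b} m"
    "integral {a..b} m' \<le> \<alpha>\<^sup>2 * \<delta>\<^sup>2 * integral {a..b} m"
    "integral {a..b} mm \<le> \<alpha> * \<delta> * integral {a..b} m"
proof -
  define N D Q K where "N = integral {a..b} m" and "D = integral {a..b} m'" and "Q = integral {a..b} mm"
    and "K = integral {a..b} (\<lambda>t. \<bar>w t\<bar>) / \<bar>integral {a..b} w\<bar>"
  have "(\<lambda>t. \<bar>w t\<bar>) integrable_on {a..b}"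
    using integrable_weight(2)[OF w_int order_refl order_refl continuous_on_const[of _ 1]] by simp
  then have nn: "N \<ge> 0" "D \<ge> 0" "Q \<ge> 0" "K \<ge> 0"
    by (auto simp: N_def D_def Q_def K_def intro!: Henstock_Kurzweil_Integration.integral_nonneg
        integrable_m divide_nonneg_nonneg)
  \<comment> \<open>An integral of a nonnegative function is nonnegative also by default, since it
    is 0 when the function is not integrable.\<close>
  have "\<alpha> \<ge> 0"
    unfolding \<alpha> using kappa_nonneg
    by (metis abs_ge_zero add_nonneg_nonneg Henstock_Kurzweil_Integration.integral_nonneg
        not_integrable_integral order_refl)
  have \<delta>K: "\<delta> = 2 + 2 * K"
    by (simp add: \<delta> K_def)
  then show "\<delta> > 0" using nn by simp
  obtain x0 where x0: "x0 \<in> {a..b}" "\<And>x. x \<in> {a..b} \<Longrightarrow> m x \<le> m x0"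
    using continuous_attains_sup[OF compact_Icc _ continuous_m(1)[OF order_refl]] ab by auto
  define S where "S = m x0"
  have S: "S > 0"
    using nonzero x0(2) by (force simp: S_def m_def)
  have D: "D \<le> \<alpha> * S"
    using dirichlet_integral_le x0(2) unfolding D_def \<alpha> S_def by blast
  have SQ: "S \<le> K * (2 * Q)"
    using sup_le[OF x0(1)] W by (simp add: S_def K_def Q_def field_simps)
  have K: "K > 0"
    using SQ S nn by (metis less_le mult_zero_left not_less)
  have AM: "2 * Q \<le> r * N + D / r" if "r > 0" for r
    using two_mm_le[OF that] by (simp add: N_def D_def Q_def)
  \<comment> \<open>For \<alpha> = 0 the integral \<open>D\<close> vanishes, so
    \<open>2 * Q \<le> r * N\<close> for every positive \<open>r\<close>. The choice
    \<open>r = Q / (N + 1)\<close> then contradicts \<open>Q > 0\<close>.\<close>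
  show \<alpha>0: "\<alpha> > 0"
  proof (rule ccontr)
    assume "\<not> \<alpha> > 0"
    then have "D = 0" using \<open>\<alpha> \<ge> 0\<close> D nn by auto
    have Q: "Q > 0"
      using SQ S K by (smt (verit) mult_nonneg_nonpos)
    have "2 * Q \<le> Q / (N + 1) * N"
      using AM[of "Q / (N + 1)"] Q nn \<open>D = 0\<close> by (simp add: add_nonneg_pos)
    also have "\<dots> \<le> Q"
      using Q nn by (simp add: field_simps)
    finally show False using Q by simp
  qed
  \<comment> \<open>The choice \<open>r = 2 * K * \<alpha>\<close> turns the \<open>D\<close> term
    into at most \<open>S / 2\<close>, which is absorbed.\<close>
  have "S \<le> K * (2 * K * \<alpha> * N + D / (2 * K * \<alpha>))"
    by (rule order_trans[OF SQ mult_left_mono[OF AM]]) (use K \<alpha>0 in auto)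
  also have "\<dots> = 2 * K\<^sup>2 * \<alpha> * N + D / (2 * \<alpha>)"
    using K \<alpha>0 by (simp add: power2_eq_square field_simps)
  also have "D / (2 * \<alpha>) \<le> S / 2"
    using D \<alpha>0 by (simp add: field_simps)
  finally have S1: "S \<le> (2 * K)\<^sup>2 * \<alpha> * N"
    by (simp add: power_mult_distrib)
  also have "\<dots> \<le> \<delta>\<^sup>2 * \<alpha> * N"
    using nn \<alpha>0 unfolding \<delta>K by (intro mult_right_mono power_mono) auto
  finally have S2: "S \<le> \<alpha> * \<delta>\<^sup>2 * N"
    by (simp add: mult_ac)
  then show "\<And>x. x \<in> {a..b} \<Longrightarrow> m x \<le> \<alpha> * \<delta>\<^sup>2 * integral {a..b} m"
    using x0(2) unfolding S_def N_def by fastforce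
  have "D \<le> \<alpha> * (\<alpha> * \<delta>\<^sup>2 * N)"
    by (rule order_trans[OF D mult_left_mono[OF S2]]) (use \<alpha>0 in auto)
  then have D2: "D \<le> \<alpha>\<^sup>2 * \<delta>\<^sup>2 * N"
    by (simp add: power2_eq_square mult_ac)
  then show "integral {a..b} m' \<le> \<alpha>\<^sup>2 * \<delta>\<^sup>2 * integral {a..b} m"
    by (simp add: D_def N_def)
  have "0 < \<alpha> * \<delta>\<^sup>2 * N"
    using S S2 by simp
  then have "N \<noteq> 0" by auto
  then show "integral {a..b} m > 0"
    using nn by (simp add: N_def)
  \<comment> \<open>The choice \<open>r = \<alpha> * \<delta>\<close> makes the bounds of the two
    terms equal.\<close>
  have "2 * Q \<le> \<alpha> * \<delta> * N + D / (\<alpha> * \<delta>)"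
    using AM[of "\<alpha> * \<delta>"] \<alpha>0 \<open>\<delta> > 0\<close> by simp
  also have "\<dots> \<le> \<alpha> * \<delta> * N + \<alpha>\<^sup>2 * \<delta>\<^sup>2 * N / (\<alpha> * \<delta>)"
    using D2 \<alpha>0 \<open>\<delta> > 0\<close> by (intro add_left_mono divide_right_mono) auto
  also have "\<dots> = 2 * (\<alpha> * \<delta> * N)"
    using \<alpha>0 \<open>\<delta> > 0\<close> by (simp add: power2_eq_square)
  finally show "integral {a..b} mm \<le> \<alpha> * \<delta> * integral {a..b} m"
    by (simp add: Q_def N_def)
qed

section \<open>Local estimates on an interval where the weight has constant sign\<close>

lemma interval_estimate:
  assumes cd: "a \<le> c" "c < d" "d \<le> b" and h: "h > 0" and \<epsilon>: "\<epsilon> > 0"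
    and M: "\<And>x. x \<in> {a..b} \<Longrightarrow> m x \<le> M"
    and E: "indicat_real E integrable_on {a..b}" "\<And>x. x \<in> {a..b} - E \<Longrightarrow> \<epsilon> \<le> \<bar>w x\<bar>"
    and sgn: "negligible N" "\<And>x. x \<in> {c..d} - N \<Longrightarrow> sgn (w x) = s"
    and B: "B = \<epsilon> * (integral {c..d} m - M * h - M * integral {c..d} (indicat_real E))"
  shows "\<bar>Im lam\<bar> * B \<le> 1 / h * integral {c..d} mm"
    "\<bar>Re lam\<bar> * B \<le> 1 / h * integral {c..d} mm + integral {c..d} m' + integral {c..d} (\<lambda>x. \<bar>q x\<bar> * m x)"
proof -
  let ?g = "tent c d h" and ?g' = "tent' c d h"
  define J where "J = integral {c..d} (\<lambda>x. w x * (?g x * m x))"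
  have sub: "{c..d} \<subseteq> {a..b}"
    using cd by auto
  have gm: "continuous_on {c..d} (\<lambda>x. ?g x * m x)"
    by (intro continuous_intros continuous_on_tent h continuous_m sub)
  have J: "((\<lambda>x. w x * (?g x * m x)) has_integral J) {c..d}"
    unfolding J_def by (rule integrable_integral[OF integrable_weight(1)[OF w_int cd(1,3) gm]])
  have absW: "(\<lambda>x. \<bar>w x\<bar> * (?g x * m x)) integrable_on {c..d}"
    by (rule integrable_weight(2)[OF w_int cd(1,3) gm])
  have absQ: "(\<lambda>x. \<bar>q x\<bar> * m x) integrable_on {c..d}"
    by (rule integrable_weight(2)[OF q_int cd(1,3) continuous_m(1)[OF sub]])
  have M0: "0 \<le> M"
    by (rule order_trans[OF m_nonneg(1) M[of c]]) (use cd in auto)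

  \<comment> \<open>A point off the null set shows that \<open>s\<close> is a value of
    \<open>sgn\<close>.\<close>
  obtain x0 where "x0 \<in> {c..d} - N"
  proof -
    have "\<not> negligible {c..d}"
      using cd(2) negligible_interval(1)[of c d] by auto
    then have "\<not> {c..d} \<subseteq> N"
      using sgn(1) negligible_subset by blast
    with that show thesis by blast
  qed
  then have s1: "\<bar>s\<bar> \<le> 1"
    using sgn(2)[of x0] by (auto simp: sgn_real_def split: if_splits)
  \<comment> \<open>The constant sign lets \<open>\<bar>w x\<bar>\<close> be written as
    \<open>s * w x\<close>, so no cancellation occurs in \<open>J\<close>.\<close>
  have "((\<lambda>x. \<bar>w x\<bar> * (?g x * m x)) has_integral s * J) {c..d}"
  proof (rule has_integral_spike[OF sgn(1) _ has_integral_mult_right[OF J]])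
    fix x assume "x \<in> {c..d} - N"
    then have "\<bar>w x\<bar> = s * w x"
      using sgn(2)[of x] by (metis abs_sgn mult.commute)
    then show "\<bar>w x\<bar> * (?g x * m x) = s * (w x * (?g x * m x))"
      by simp
  qed
  then have "integral {c..d} (\<lambda>x. \<bar>w x\<bar> * (?g x * m x)) = s * J"
    by (simp add: has_integral_iff)
  also have "\<dots> \<le> \<bar>s\<bar> * \<bar>J\<bar>"
    by (metis abs_ge_self abs_mult)
  also have "\<dots> \<le> \<bar>J\<bar>"
    using s1 by (simp add: mult_left_le_one_le)
  finally have upper: "integral {c..d} (\<lambda>x. \<bar>w x\<bar> * (?g x * m x)) \<le> \<bar>J\<bar>" .

  have mI: "m integrable_on {c..d}" and tI: "(\<lambda>x. 1 - ?g x) integrable_on {c..d}"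
    and EI: "indicat_real E integrable_on {c..d}"
    using integrable_m(1)[OF cd(1,3)] integrable_on_subinterval[OF E(1) sub]
    by (auto intro!: integrable_continuous_real continuous_intros continuous_on_tent h)
  \<comment> \<open>A pointwise minorant of the weighted density: on \<open>E\<close> it is
    nonpositive because \<open>m\<close> is at most \<open>M\<close>, and off \<open>E\<close> the
    term \<open>M * (1 - ?g x)\<close> takes away at least the part of \<open>m\<close> cut off by
    the tent. \<open>B\<close> may be negative on a short interval; only the sum over all intervals
    has to be positive.\<close>
  have lowerI: "((\<lambda>x. \<epsilon> * (m x - M * (1 - ?g x) - M * indicat_real E x)) has_integral
      \<epsilon> * (integral {c..d} m - M * integral {c..d} (\<lambda>x. 1 - ?g x) - M * integral {c..d} (indicat_real E))) {c..d}"
    by (intro has_integral_mult_right has_integral_diff integrable_integral mI tI EI)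
  have "B \<le> \<epsilon> * (integral {c..d} m - M * integral {c..d} (\<lambda>x. 1 - ?g x) - M * integral {c..d} (indicat_real E))"
    unfolding B using \<epsilon> M0 integral_one_minus_tent_le[OF less_imp_le[OF cd(2)] h]
    by (intro mult_left_mono diff_mono) auto
  also have "\<dots> \<le> integral {c..d} (\<lambda>x. \<bar>w x\<bar> * (?g x * m x))"
  proof (rule has_integral_le[OF lowerI integrable_integral[OF absW]])
    fix x assume x: "x \<in> {c..d}"
    note t = tent_bounds[OF h x]
    have mx: "m x \<le> M"
      using M x sub by auto
    have loss: "m x * (1 - ?g x) \<le> M * (1 - ?g x)"
      using t mx by (intro mult_right_mono) auto
    show "\<epsilon> * (m x - M * (1 - ?g x) - M * indicat_real E x) \<le> \<bar>w x\<bar> * (?g x * m x)"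
    proof (cases "x \<in> E")
      case True
      have "0 \<le> M * (1 - ?g x)"
        using M0 t by simp
      then have "\<epsilon> * (m x - M * (1 - ?g x) - M * indicat_real E x) \<le> 0"
        using mx True \<epsilon> by (intro mult_nonneg_nonpos) auto
      also have "0 \<le> \<bar>w x\<bar> * (?g x * m x)"
        using t by simp
      finally show ?thesis .
    next
      case False
      have "\<epsilon> * (m x - M * (1 - ?g x) - M * indicat_real E x) \<le> \<epsilon> * (?g x * m x)"
        using loss False \<epsilon> by (intro mult_left_mono) (auto simp: algebra_simps)
      also have "\<dots> \<le> \<bar>w x\<bar> * (?g x * m x)"
        using E(2)[of x] False x sub t by (intro mult_right_mono) auto
      finally show ?thesis .
    qed
  qed
  also note upper
  finally have BJ: "B \<le> \<bar>J\<bar>" .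

  let ?Z = "{c + h, d - h, (c + d) / 2}"
  have I: "((\<lambda>x. of_real (?g' x) * bracket f f' x + of_real (?g x * (m' x + q x * m x))
        - lam * of_real (w x * (?g x * m x)))
      has_integral (of_real (?g d) * bracket f f' d - of_real (?g c) * bracket f f' c)) {c..d}" (is "(?I has_integral ?r) _")
  proof (rule weighted_identity[OF cd(1) less_imp_le[OF cd(2)] cd(3) lipschitz_on_tent[OF h]])
    show "negligible ?Z" by simp
    show "(?g has_real_derivative ?g' x) (at x within {c..d})" if "x \<in> {c..d} - ?Z" for x
      using that by (intro has_field_derivative_at_within[OF tent_has_derivative[OF h]]) auto
  qed
  have r: "?r = 0"
    using cd h by simp
  have mmI: "(\<lambda>x. 1 / h * mm x) integrable_on {c..d}"
    by (intro integrable_on_mult_right integrable_m cd)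
  have bound: "\<bar>?g' x\<bar> * \<bar>Im (bracket f f' x)\<bar> \<le> 1 / h * mm x"
    "\<bar>?g' x\<bar> * \<bar>Re (bracket f f' x)\<bar> \<le> 1 / h * mm x" for x
  proof -
    have "cmod (bracket f f' x) = mm x"
      by (simp add: bracket_def mm_def norm_mult)
    then show "\<bar>?g' x\<bar> * \<bar>Im (bracket f f' x)\<bar> \<le> 1 / h * mm x"
      "\<bar>?g' x\<bar> * \<bar>Re (bracket f f' x)\<bar> \<le> 1 / h * mm x"
      using mult_mono[OF abs_tent'_le[OF h] abs_Im_le_cmod] mult_mono[OF abs_tent'_le[OF h] abs_Re_le_cmod] h
      by (metis abs_ge_zero divide_nonneg_pos less_eq_real_def zero_less_one)+
  qed

  \<comment> \<open>Adding the \<open>lam\<close> term back isolates \<open>Im lam * J\<close>. The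
    terms with \<open>m'\<close> and \<open>q\<close> are real, so only the one with
    \<open>?g'\<close> survives.\<close>
  have "((\<lambda>x. Im (?I x) + Im lam * (w x * (?g x * m x))) has_integral (Im ?r + Im lam * J)) {c..d}"
    using has_integral_add[OF has_integral_linear[OF I bounded_linear_Im] has_integral_mult_right[OF J]]
    by (simp only: o_def)
  then have ImI: "((\<lambda>x. ?g' x * Im (bracket f f' x)) has_integral (Im lam * J)) {c..d}"
    unfolding r by simp
  then have "\<bar>Im lam * J\<bar> = \<bar>integral {c..d} (\<lambda>x. ?g' x * Im (bracket f f' x))\<bar>"
    by (simp add: has_integral_iff)
  also have "\<dots> \<le> integral {c..d} (\<lambda>x. 1 / h * mm x)"
    using ImI mmI bound(1) by (intro abs_integral_mono) (auto simp: abs_mult)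
  finally have "\<bar>Im lam\<bar> * \<bar>J\<bar> \<le> 1 / h * integral {c..d} mm"
    by (simp add: abs_mult)
  with BJ show "\<bar>Im lam\<bar> * B \<le> 1 / h * integral {c..d} mm"
    by (meson abs_ge_zero mult_left_mono order_trans)

  \<comment> \<open>The real part also keeps the terms with \<open>m'\<close> and \<open>q\<close>,
    where the tent is bounded by 1.\<close>
  have "((\<lambda>x. Re (?I x) + Re lam * (w x * (?g x * m x))) has_integral (Re ?r + Re lam * J)) {c..d}"
    using has_integral_add[OF has_integral_linear[OF I bounded_linear_Re] has_integral_mult_right[OF J]]
    by (simp only: o_def)
  then have ReI: "((\<lambda>x. ?g' x * Re (bracket f f' x) + ?g x * (m' x + q x * m x)) has_integral (Re lam * J)) {c..d}"
    unfolding r by simp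
  then have "\<bar>Re lam * J\<bar> = \<bar>integral {c..d} (\<lambda>x. ?g' x * Re (bracket f f' x) + ?g x * (m' x + q x * m x))\<bar>"
    by (simp add: has_integral_iff)
  also have "\<dots> \<le> integral {c..d} (\<lambda>x. 1 / h * mm x + m' x + \<bar>q x\<bar> * m x)"
  proof (rule abs_integral_mono)
    show "(\<lambda>x. 1 / h * mm x + m' x + \<bar>q x\<bar> * m x) integrable_on {c..d}"
      by (intro Henstock_Kurzweil_Integration.integrable_add mmI absQ integrable_m cd)
    fix x assume x: "x \<in> {c..d}"
    have "\<bar>?g x * (m' x + q x * m x)\<bar> \<le> 1 * (m' x + \<bar>q x\<bar> * m x)"
      unfolding abs_mult using tent_bounds[OF h x] abs_triangle_ineq[of "m' x" "q x * m x"]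
      by (intro mult_mono) (auto simp: abs_mult)
    moreover have "\<bar>?g' x * Re (bracket f f' x)\<bar> \<le> 1 / h * mm x"
      using bound(2)[of x] by (simp only: abs_mult)
    ultimately have "\<bar>?g' x * Re (bracket f f' x) + ?g x * (m' x + q x * m x)\<bar>
        \<le> 1 / h * mm x + 1 * (m' x + \<bar>q x\<bar> * m x)"
      using add_mono order_trans[OF abs_triangle_ineq] by blast
    then show "\<bar>?g' x * Re (bracket f f' x) + ?g x * (m' x + q x * m x)\<bar> \<le> 1 / h * mm x + m' x + \<bar>q x\<bar> * m x"
      by (simp only: mult_1 add.assoc)
  qed (use ReI in auto)
  also have "\<dots> = 1 / h * integral {c..d} mm + integral {c..d} m' + integral {c..d} (\<lambda>x. \<bar>q x\<bar> * m x)"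
    by (intro integral_unique has_integral_add has_integral_mult_right integrable_integral absQ integrable_m cd)
  finally have "\<bar>Re lam\<bar> * \<bar>J\<bar> \<le> \<dots>"
    by (simp add: abs_mult)
  with BJ show "\<bar>Re lam\<bar> * B \<le> 1 / h * integral {c..d} mm + integral {c..d} m' + integral {c..d} (\<lambda>x. \<bar>q x\<bar> * m x)"
    by (meson abs_ge_zero mult_left_mono order_trans)
qed

text \<open>Summed over the n + 1 intervals, all terms become multiples of the integral of
  \<open>m\<close>, which is positive and cancels.\<close>

theorem eigenvalue_bounds:
  assumes W: "integral {a..b} w \<noteq> 0"
    and \<alpha>: "\<alpha> = \<kappa> + integral {a..b} (\<lambda>x. \<bar>min 0 (q x)\<bar>)"
    and \<delta>: "\<delta> = 2 + 2 * (integral {a..b} (\<lambda>t. \<bar>w t\<bar>) / \<bar>integral {a..b} w\<bar>)"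
    and \<epsilon>: "\<epsilon> > 0"
    and E: "indicat_real E integrable_on {a..b}" "\<And>x. x \<in> {a..b} - E \<Longrightarrow> \<epsilon> \<le> \<bar>w x\<bar>"
      "integral {a..b} (indicat_real E) \<le> 1 / (4 * \<alpha> * \<delta>\<^sup>2)"
    and x: "x 0 = a" "x (Suc n) = b" "\<And>k. k \<le> n \<Longrightarrow> x k < x (Suc k)"
    and sgn: "\<And>k. k \<le> n \<Longrightarrow> \<exists>N. negligible N \<and> (\<forall>t\<in>{x k..x (Suc k)} - N. sgn (w t) = s k)"
  shows "\<bar>Im lam\<bar> \<le> 8 / \<epsilon> * \<alpha>\<^sup>2 * \<delta> ^ 3 * (real n + 1)"
    "\<bar>Re lam\<bar> \<le> 2 / \<epsilon> * \<alpha> * \<delta>\<^sup>2 * (4 * \<alpha> * \<delta> * (real n + 1) + \<alpha> + integral {a..b} (\<lambda>x. \<bar>q x\<bar>))"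
proof -
  note ap = a_priori_bounds[OF W \<alpha> \<delta>]
  \<comment> \<open>\<open>h\<close> is chosen so that the n + 1 cut-off losses \<open>M * h\<close>
    add up to \<open>N / 4\<close>.\<close>
  define N M h where "N = integral {a..b} m" and "M = \<alpha> * \<delta>\<^sup>2 * N"
    and "h = 1 / (4 * \<alpha> * \<delta>\<^sup>2 * (real n + 1))"
  have pos: "N > 0" "M > 0" "h > 0" "\<alpha> > 0" "\<delta> > 0"
    using ap(1-3) by (auto simp: N_def M_def h_def)
  have M: "m t \<le> M" if "t \<in> {a..b}" for t
    using ap(4)[OF that] by (simp add: M_def N_def)
  have incr: "a \<le> x k" if "k \<le> Suc n" for k
    using that
  proof (induction k)
    case (Suc k)
    then show ?case
      using x(3)[of k] by simp
  qed (simp add: x(1))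
  \<comment> \<open>Induction from the right: \<open>k\<close> counts the steps back from
    \<open>x (Suc n) = b\<close>.\<close>
  have incr': "x (Suc n - k) \<le> b" if "k \<le> Suc n" for k
    using that
  proof (induction k)
    case (Suc k)
    then have "x (Suc n - Suc k) \<le> x (Suc (n - k))"
      by (simp add: less_imp_le[OF x(3)])
    also have "Suc (n - k) = Suc n - k"
      using Suc by simp
    finally show ?case
      using Suc by simp
  qed (simp add: x(2))
  have xb: "x (Suc k) \<le> b" if "k \<le> n" for k
    using incr'[of "n - k"] that by simp
  define B where "B k = \<epsilon> * (integral {x k..x (Suc k)} m - M * h - M * integral {x k..x (Suc k)} (indicat_real E))" for k
  have est: "\<bar>Im lam\<bar> * B k \<le> 1 / h * integral {x k..x (Suc k)} mm"
    "\<bar>Re lam\<bar> * B k \<le> 1 / h * integral {x k..x (Suc k)} mm + integral {x k..x (Suc k)} m'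
        + integral {x k..x (Suc k)} (\<lambda>t. \<bar>q t\<bar> * m t)" if k: "k \<le> n" for k
  proof -
    obtain Z where "negligible Z" "\<And>t. t \<in> {x k..x (Suc k)} - Z \<Longrightarrow> sgn (w t) = s k"
      using sgn[OF k] by blast
    from interval_estimate[OF incr x(3) xb pos(3) \<epsilon> M E(1,2) this B_def]
    show "\<bar>Im lam\<bar> * B k \<le> 1 / h * integral {x k..x (Suc k)} mm"
      "\<bar>Re lam\<bar> * B k \<le> 1 / h * integral {x k..x (Suc k)} mm + integral {x k..x (Suc k)} m'
        + integral {x k..x (Suc k)} (\<lambda>t. \<bar>q t\<bar> * m t)"
      using k by auto
  qed
  have sum: "(\<Sum>k\<le>n. integral {x k..x (Suc k)} F) = integral {a..b} F"
    if "F integrable_on {a..b}" for F :: "real \<Rightarrow> real"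
    using sum_integral_consecutive[of n x F] that x less_imp_le by auto
  have mI: "m integrable_on {a..b}" "m' integrable_on {a..b}" "mm integrable_on {a..b}"
    by (auto intro: integrable_m)
  have qI: "(\<lambda>t. \<bar>q t\<bar> * m t) integrable_on {a..b}" "(\<lambda>t. \<bar>q t\<bar> * M) integrable_on {a..b}"
    by (auto intro!: integrable_weight(2)[OF q_int order_refl order_refl] continuous_m
        simp del: integrable_on_mult_left_iff)
  \<comment> \<open>The bound on the measure of \<open>E\<close> is matched to \<open>M\<close>: the
    factor \<open>\<alpha> * \<delta>\<^sup>2\<close> cancels.\<close>
  have "M * integral {a..b} (indicat_real E) \<le> M * (1 / (4 * \<alpha> * \<delta>\<^sup>2))"
    using pos by (intro mult_left_mono E(3)) auto
  also have "\<dots> = N / 4"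
    using pos by (simp add: M_def)
  finally have lossE: "M * integral {a..b} (indicat_real E) \<le> N / 4" .
  have lossh: "(real n + 1) * (M * h) = N / 4"
    using pos by (simp add: M_def h_def field_simps)
  have "(\<Sum>k\<le>n. B k) = \<epsilon> * (N - (real n + 1) * (M * h) - M * integral {a..b} (indicat_real E))"
    by (simp add: B_def sum_distrib_left[symmetric] sum_subtractf sum[OF mI(1)] sum[OF E(1)] N_def add.commute)
  also have "\<dots> \<ge> \<epsilon> * (N / 2)"
    using lossE \<epsilon> unfolding lossh by (intro mult_left_mono) auto
  finally have sumB: "\<epsilon> * N / 2 \<le> (\<Sum>k\<le>n. B k)" by simp
  \<comment> \<open>Two of the three powers of \<delta> come from \<open>1 / h\<close>, the third
    from the bound on \<open>mm\<close>.\<close>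
  have Q: "1 / h * integral {a..b} mm \<le> 4 * \<alpha>\<^sup>2 * \<delta> ^ 3 * (real n + 1) * N"
  proof -
    have "1 / h * integral {a..b} mm \<le> 1 / h * (\<alpha> * \<delta> * N)"
      using ap(6) pos by (intro mult_left_mono) (auto simp: N_def)
    also have "\<dots> = 4 * \<alpha>\<^sup>2 * \<delta> ^ 3 * (real n + 1) * N"
      by (simp add: h_def power2_eq_square power3_eq_cube mult_ac)
    finally show ?thesis .
  qed

  have "\<bar>Im lam\<bar> * (\<epsilon> * N / 2) \<le> \<bar>Im lam\<bar> * (\<Sum>k\<le>n. B k)"
    using sumB by (rule mult_left_mono) simp
  also have "\<dots> \<le> (\<Sum>k\<le>n. 1 / h * integral {x k..x (Suc k)} mm)"
    unfolding sum_distrib_left using est(1) by (intro sum_mono) auto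
  also have "\<dots> = 1 / h * integral {a..b} mm"
    by (simp only: sum_distrib_left[symmetric] sum[OF mI(3)])
  also note Q
  finally have "\<bar>Im lam\<bar> * (\<epsilon> / 2) * N \<le> 4 * \<alpha>\<^sup>2 * \<delta> ^ 3 * (real n + 1) * N"
    by simp
  then have "\<bar>Im lam\<bar> * (\<epsilon> / 2) \<le> 4 * \<alpha>\<^sup>2 * \<delta> ^ 3 * (real n + 1)"
    using pos(1) by (rule mult_right_le_imp_le)
  then show "\<bar>Im lam\<bar> \<le> 8 / \<epsilon> * \<alpha>\<^sup>2 * \<delta> ^ 3 * (real n + 1)"
    using \<epsilon> by (simp add: field_simps)

  \<comment> \<open>As \<open>q\<close> is only integrable, this term is bounded through the
    supremum of \<open>m\<close>.\<close>
  have "integral {a..b} (\<lambda>t. \<bar>q t\<bar> * m t) \<le> integral {a..b} (\<lambda>t. \<bar>q t\<bar> * M)"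
    using qI M by (intro integral_le mult_left_mono) auto
  then have qm: "integral {a..b} (\<lambda>t. \<bar>q t\<bar> * m t) \<le> integral {a..b} (\<lambda>t. \<bar>q t\<bar>) * M"
    by simp
  have "\<bar>Re lam\<bar> * (\<epsilon> * N / 2) \<le> \<bar>Re lam\<bar> * (\<Sum>k\<le>n. B k)"
    using sumB by (rule mult_left_mono) simp
  also have "\<dots> \<le> (\<Sum>k\<le>n. 1 / h * integral {x k..x (Suc k)} mm + integral {x k..x (Suc k)} m'
        + integral {x k..x (Suc k)} (\<lambda>t. \<bar>q t\<bar> * m t))"
    unfolding sum_distrib_left using est(2) by (intro sum_mono) auto
  also have "\<dots> = 1 / h * integral {a..b} mm + integral {a..b} m' + integral {a..b} (\<lambda>t. \<bar>q t\<bar> * m t)"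
    by (simp only: sum.distrib sum_distrib_left[symmetric] sum[OF mI(3)] sum[OF mI(2)] sum[OF qI(1)])
  also have "\<dots> \<le> 4 * \<alpha>\<^sup>2 * \<delta> ^ 3 * (real n + 1) * N + \<alpha>\<^sup>2 * \<delta>\<^sup>2 * N + integral {a..b} (\<lambda>t. \<bar>q t\<bar>) * M"
    using Q ap(5) qm by (intro add_mono) (auto simp: N_def)
  also have "\<dots> = \<alpha> * \<delta>\<^sup>2 * (4 * \<alpha> * \<delta> * (real n + 1) + \<alpha> + integral {a..b} (\<lambda>x. \<bar>q x\<bar>)) * N"
    by (simp add: M_def power2_eq_square power3_eq_cube algebra_simps)
  finally have "\<bar>Re lam\<bar> * (\<epsilon> / 2) * N
      \<le> \<alpha> * \<delta>\<^sup>2 * (4 * \<alpha> * \<delta> * (real n + 1) + \<alpha> + integral {a..b} (\<lambda>x. \<bar>q x\<bar>)) * N"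
    by simp
  then have "\<bar>Re lam\<bar> * (\<epsilon> / 2)
      \<le> \<alpha> * \<delta>\<^sup>2 * (4 * \<alpha> * \<delta> * (real n + 1) + \<alpha> + integral {a..b} (\<lambda>x. \<bar>q x\<bar>))" (is "_ \<le> ?X")
    using pos(1) by (rule mult_right_le_imp_le)
  then have "\<bar>Re lam\<bar> \<le> ?X / (\<epsilon> / 2)"
    using \<epsilon> by (subst pos_le_divide_eq) auto
  also have "\<dots> = 2 / \<epsilon> * ?X"
    by simp
  finally show "\<bar>Re lam\<bar> \<le> 2 / \<epsilon> * \<alpha> * \<delta>\<^sup>2 * (4 * \<alpha> * \<delta> * (real n + 1) + \<alpha> + integral {a..b} (\<lambda>x. \<bar>q x\<bar>))"
    by (simp only: mult.assoc)
qed

end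

section \<open>From Lebesgue integrals on the open interval to gauge integrals on the closed
  one\<close>

lemma AE_lebesgue_on_imp_negligible:
  assumes "AE x in lebesgue_on S. P x" "S \<in> sets lebesgue"
  obtains N where "negligible N" "\<And>x. x \<in> S - N \<Longrightarrow> P x"
proof -
  have "AE x in lebesgue. x \<in> S \<longrightarrow> P x"
    using assms by (simp add: AE_restrict_space_iff)
  then obtain N where "N \<in> null_sets lebesgue" "{x \<in> space lebesgue. \<not> (x \<in> S \<longrightarrow> P x)} \<subseteq> N"
    by (rule AE_E3) auto
  then show thesis
    by (intro that[of N]) (auto simp: negligible_iff_null_sets)
qed

lemma integrable_leb_imp_absolutely_integrable:
  fixes v :: "real \<Rightarrow> real"
  assumes "integrable (leb a b) v"
  shows "v absolutely_integrable_on {a..b}"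
proof -
  have "v absolutely_integrable_on {a<..<b}"
    using assms by (simp add: set_integrable_def integrable_restrict_space)
  then show ?thesis
    by (simp only: absolutely_integrable_on_Icc_iff_Ioo)
qed

lemma lebesgue_integral_leb:
  fixes v :: "real \<Rightarrow> real"
  assumes "integrable (leb a b) v"
  shows "(\<integral>x. v x \<partial>leb a b) = integral {a..b} v"
  using lebesgue_integral_eq_integral[OF assms] by (simp add: integral_open_interval_real)

lemma abs_mult_cmod_square_le:
  assumes "(cmod y)\<^sup>2 \<le> S"
  shows "\<bar>r * (cmod y)\<^sup>2\<bar> \<le> \<bar>r\<bar> * S"
  using assms by (simp add: abs_mult mult_left_mono)

section \<open>Boundary conditions\<close>

text \<open>Here \<open>u\<close> and \<open>v\<close> stand for the values at \<open>b\<close>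
  without the phase. If \<open>r12 = 0\<close>, the determinant makes the terms with
  \<open>y'\<close> cancel. In general, multiplication by \<open>r12\<close> eliminates both
  derivatives, via \<open>r12 * y' = u - r11 * y\<close> and
  \<open>r12 * v = r22 * u - y\<close>.\<close>

lemma boundary_form_coupled:
  fixes y y' u v :: complex
  assumes det: "r11 * r22 - r12 * r21 = 1"
    and u: "u = of_real r11 * y + of_real r12 * y'" and v: "v = of_real r21 * y + of_real r22 * y'"
  shows "r12 = 0 \<Longrightarrow> v * cnj u - y' * cnj y = of_real (r11 * r21 * (cmod y)\<^sup>2)"
    "of_real r12 * (v * cnj u - y' * cnj y)
      = of_real (r22 * (cmod u)\<^sup>2 + r11 * (cmod y)\<^sup>2 - 2 * Re (u * cnj y))"
proof -
  have d: "complex_of_real r11 * of_real r22 - of_real r12 * of_real r21 = 1"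
    using det by (metis of_real_1 of_real_diff of_real_mult)
  show "v * cnj u - y' * cnj y = of_real (r11 * r21 * (cmod y)\<^sup>2)" if "r12 = 0"
  proof -
    \<comment> \<open>The remainder carries the factor \<open>det R - 1\<close>, so this is a
      polynomial identity and \<open>d\<close> removes the remainder.\<close>
    have "v * cnj u - y' * cnj y = of_real r11 * of_real r21 * (y * cnj y)
        + (of_real r11 * of_real r22 - of_real r12 * of_real r21 - 1) * (y' * cnj y)"
      using that by (simp add: u v algebra_simps)
    then show ?thesis
      unfolding d by (simp only: of_real_mult complex_norm_square) simp
  qed
  have "of_real r12 * (v * cnj u - y' * cnj y)
    = of_real r22 * (u * cnj u) + of_real r11 * (y * cnj y) - (u * cnj y + cnj (u * cnj y))
      - (of_real r11 * of_real r22 - of_real r12 * of_real r21 - 1) * (y * cnj u)"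
    by (simp add: u v algebra_simps)
  then show "of_real r12 * (v * cnj u - y' * cnj y)
      = of_real (r22 * (cmod u)\<^sup>2 + r11 * (cmod y)\<^sup>2 - 2 * Re (u * cnj y))"
    unfolding d by (simp only: of_real_add of_real_diff of_real_mult complex_norm_square complex_add_cnj) simp
qed

lemma c_const_nonneg: "c_const bd \<ge> 0"
  by (cases bd rule: c_const.cases) auto

lemma boundary_form:
  assumes valid: "valid_boundary_data bd" and f: "f \<in> sa_domain a b q w bd"
  shows "Im (bracket f (deriv_on a b f) b - bracket f (deriv_on a b f) a) = 0"
    "\<lbrakk>(cmod (f a))\<^sup>2 \<le> S; (cmod (f b))\<^sup>2 \<le> S\<rbrakk>
      \<Longrightarrow> Re (bracket f (deriv_on a b f) b - bracket f (deriv_on a b f) a) \<le> c_const bd * S"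
proof -
  let ?D = "bracket f (deriv_on a b f) b - bracket f (deriv_on a b f) a"
  \<comment> \<open>A Dirichlet condition makes both sides zero, so it counts as slope 0, in
    agreement with \<open>c_const\<close>.\<close>
  have sep: "slope_cond s y y' \<Longrightarrow> y' * cnj y = of_real ((case s of Finite l \<Rightarrow> l | Infinite \<Rightarrow> 0) * (cmod y)\<^sup>2)" for s y y'
    by (cases s) (simp_all only: slope_cond.simps slope.case of_real_mult complex_norm_square, simp_all)
  have "Im ?D = 0 \<and> ((cmod (f a))\<^sup>2 \<le> S \<longrightarrow> (cmod (f b))\<^sup>2 \<le> S \<longrightarrow> Re ?D \<le> c_const bd * S)"
  proof (cases bd)
    case (Sep l r)
    define l0 r0 :: real where "l0 = (case l of Finite l \<Rightarrow> l | Infinite \<Rightarrow> 0)"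
      and "r0 = (case r of Finite l \<Rightarrow> l | Infinite \<Rightarrow> 0)"
    have c: "c_const bd = \<bar>l0\<bar> + \<bar>r0\<bar>"
      unfolding Sep by (cases l; cases r) (simp_all add: l0_def r0_def)
    have "slope_cond l (f a) (deriv_on a b f a)" "slope_cond r (f b) (deriv_on a b f b)"
      using f by (simp_all add: Sep)
    then have D: "?D = of_real (r0 * (cmod (f b))\<^sup>2 - l0 * (cmod (f a))\<^sup>2)"
      unfolding bracket_def l0_def r0_def of_real_diff by (simp only: sep)
    have "r0 * (cmod (f b))\<^sup>2 - l0 * (cmod (f a))\<^sup>2 \<le> c_const bd * S"
      if "(cmod (f a))\<^sup>2 \<le> S" "(cmod (f b))\<^sup>2 \<le> S"
      using abs_mult_cmod_square_le[OF that(1), of l0] abs_mult_cmod_square_le[OF that(2), of r0]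
      unfolding c distrib_right by linarith
    then show ?thesis
      unfolding D by simp
  next
    case (Coup \<phi> R)
    let ?y = "f a" and ?y' = "deriv_on a b f a" and ?e = "exp (\<i> * complex_of_real \<phi>)"
    define u v where "u = of_real (R$1$1) * ?y + of_real (R$1$2) * ?y'"
      and "v = of_real (R$2$1) * ?y + of_real (R$2$2) * ?y'"
    have fb: "f b = ?e * u" "deriv_on a b f b = ?e * v"
      using f by (simp_all add: Coup u_def v_def)
    have "cmod ?e = 1" by simp
    \<comment> \<open>The phase has modulus 1 and cancels in the boundary term.\<close>
    then have "?e * cnj ?e = 1"
      by (metis complex_norm_square of_real_1 one_power2)
    then have D: "?D = v * cnj u - ?y' * cnj ?y"
      by (simp add: bracket_def fb)
    have cu: "cmod (f b) = cmod u"
      by (simp add: fb norm_mult)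
    have det: "R$1$1 * R$2$2 - R$1$2 * R$2$1 = 1"
      using valid by (simp add: Coup det_2)
    note form = boundary_form_coupled[OF det u_def v_def]
    show ?thesis
    proof (cases "R$1$2 = 0")
      case True
      have D': "?D = of_real (R$1$1 * R$2$1 * (cmod ?y)\<^sup>2)"
        unfolding D by (rule form(1)[OF True])
      show ?thesis
        unfolding D' using abs_mult_cmod_square_le[of ?y S "R$1$1 * R$2$1"] True by (auto simp: Coup abs_le_iff)
    next
      case False
      define X where "X = R$2$2 * (cmod u)\<^sup>2 + R$1$1 * (cmod ?y)\<^sup>2 - 2 * Re (u * cnj ?y)"
      have "?D = of_real (X / R$1$2)"
        using form(2) False by (simp add: D X_def field_simps del: of_real_diff of_real_add of_real_mult)
      moreover have "X / R$1$2 \<le> c_const bd * S" if "(cmod ?y)\<^sup>2 \<le> S" "(cmod u)\<^sup>2 \<le> S"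
      proof -
        have "\<bar>Re (u * cnj ?y)\<bar> \<le> cmod u * cmod ?y"
          using abs_Re_le_cmod[of "u * cnj ?y"] by (simp add: norm_mult)
        \<comment> \<open>The mixed term is at most \<open>2 * S\<close>; this is the summand 2 in
          \<open>c_const\<close>.\<close>
        then have "2 * \<bar>Re (u * cnj ?y)\<bar> \<le> (cmod u)\<^sup>2 + (cmod ?y)\<^sup>2"
          using sum_squares_bound[of "cmod u" "cmod ?y"] by linarith
        then have "\<bar>X\<bar> \<le> \<bar>R$2$2\<bar> * S + \<bar>R$1$1\<bar> * S + 2 * S"
          using abs_mult_cmod_square_le[OF that(1), of "R$1$1"] abs_mult_cmod_square_le[OF that(2), of "R$2$2"] that
          unfolding X_def by linarith
        then have "\<bar>X / R$1$2\<bar> \<le> (\<bar>R$2$2\<bar> * S + \<bar>R$1$1\<bar> * S + 2 * S) / \<bar>R$1$2\<bar>"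
          by (simp add: divide_right_mono)
        also have "\<dots> = c_const bd * S"
          using False by (simp add: Coup algebra_simps add_divide_distrib)
        finally show ?thesis
          by (rule order_trans[OF abs_ge_self])
      qed
      ultimately show ?thesis by (simp add: cu)
    qed
  qed
  then show "Im ?D = 0" "\<lbrakk>(cmod (f a))\<^sup>2 \<le> S; (cmod (f b))\<^sup>2 \<le> S\<rbrakk> \<Longrightarrow> Re ?D \<le> c_const bd * S"
    by blast+
qed

section \<open>Application to the boundary value problem\<close>

theorem corollary3p7:
  fixes a b \<alpha> \<delta> \<epsilon> :: real and q w :: "real \<Rightarrow> real" and n :: nat
    and bd :: boundary_data and lam :: complex
  assumes "a < b"
    and "integrable (leb a b) q"
    and "integrable (leb a b) w"
    and "AE x in leb a b. w x \<noteq> 0"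
    and "emeasure lebesgue {x\<in>{a<..<b}. w x > 0} > 0"
    and "emeasure lebesgue {x\<in>{a<..<b}. w x < 0} > 0"
    and "(\<integral>x. w x \<partial>leb a b) \<noteq> 0"
    and "has_turning_points a b w n"
    and "valid_boundary_data bd"
    and "\<alpha> = c_const bd + L1_norm a b (\<lambda>x. min 0 (q x))"
    and "\<delta> = 2 + 2 * (L1_norm a b w / \<bar>\<integral>x. w x \<partial>leb a b\<bar>)"
    and "\<epsilon> > 0"
    and "emeasure lebesgue {x\<in>{a<..<b}. \<bar>w x\<bar> < \<epsilon>} \<le> 1 / ennreal (4 * \<alpha> * \<delta>\<^sup>2)"
    and "is_eigenvalue a b q w (sa_domain a b q w bd) lam"
    and "lam \<notin> \<real>"
  shows "\<bar>Im lam\<bar> \<le> 8 / \<epsilon> * \<alpha>\<^sup>2 * \<delta> ^ 3 * (real n + 1) \<and>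
         \<bar>Re lam\<bar> \<le> 2 / \<epsilon> * \<alpha> * \<delta>\<^sup>2 * (4 * \<alpha> * \<delta> * (real n + 1) + \<alpha> + L1_norm a b q)"
proof -
  note ab = assms(1) and q = assms(2) and w = assms(3)
  have L1: "L1_norm a b v = integral {a..b} (\<lambda>x. \<bar>v x\<bar>)" if "integrable (leb a b) v" for v
    unfolding L1_norm_def using that by (intro lebesgue_integral_leb) simp
  have qneg: "integrable (leb a b) (\<lambda>x. min 0 (q x))"
    using q by (intro integrable_min) auto
  obtain f where f: "f \<in> sa_domain a b q w bd" "\<exists>x\<in>{a<..<b}. f x \<noteq> 0"
    and tau: "is_tau a b q w f (\<lambda>x. lam * f x)"
    using assms(14) unfolding is_eigenvalue_def by blast
  have fD: "f \<in> D_max a b q w"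
    using f(1) by (cases bd) auto
  interpret indefinite_eigenfunction a b q w lam f "deriv_on a b f" "c_const bd"
  proof
    show "q absolutely_integrable_on {a..b}" "w absolutely_integrable_on {a..b}"
      using q w by (auto intro: integrable_leb_imp_absolutely_integrable)
    show "(f has_vector_derivative deriv_on a b f x) (at x within {a..b})" if "x \<in> {a..b}" for x
      using fD that by (auto simp: D_max_def deriv_on_def vector_derivative_works[symmetric])
    show "abs_cont_on a b f" "abs_cont_on a b (deriv_on a b f)"
      using fD by (auto simp: D_max_def)
    have "AE x in leb a b. w x \<noteq> 0 \<and> (\<exists>f2. (deriv_on a b f has_vector_derivative f2) (at x) \<and>
        lam * f x = 1 / complex_of_real (w x) * (- f2 + complex_of_real (q x) * f x))"
      using assms(4) tau unfolding is_tau_def by auto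
    then obtain N where N: "negligible N" "\<And>x. x \<in> {a<..<b} - N \<Longrightarrow>
       w x \<noteq> 0 \<and> (\<exists>f2. (deriv_on a b f has_vector_derivative f2) (at x) \<and>
        lam * f x = 1 / complex_of_real (w x) * (- f2 + complex_of_real (q x) * f x))"
      by (rule AE_lebesgue_on_imp_negligible) auto
    show "\<exists>N. negligible N \<and> (\<forall>x\<in>{a..b} - N. (deriv_on a b f has_vector_derivative
        (of_real (q x) - lam * of_real (w x)) * f x) (at x within {a..b}))"
    \<comment> \<open>The equation is given on the open interval only, so the end points join the
      exceptional set.\<close>
    proof (intro exI[of _ "N \<union> {a, b}"] conjI ballI)
      show "negligible (N \<union> {a, b})"
        using N(1) by simp
      fix x assume "x \<in> {a..b} - (N \<union> {a, b})"
      then obtain f2 where f2: "w x \<noteq> 0" "(deriv_on a b f has_vector_derivative f2) (at x)"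
        "lam * f x = 1 / complex_of_real (w x) * (- f2 + complex_of_real (q x) * f x)"
        using N(2)[of x] by fastforce
      have "f2 = (of_real (q x) - lam * of_real (w x)) * f x"
        using f2(1,3) by (simp add: field_simps)
      with f2(2) show "(deriv_on a b f has_vector_derivative
          (of_real (q x) - lam * of_real (w x)) * f x) (at x within {a..b})"
        by (auto intro: has_vector_derivative_at_within)
    qed
    show "\<exists>x\<in>{a..b}. f x \<noteq> 0"
      using f(2) by force
    show "Im lam \<noteq> 0"
      using assms(15) by (simp add: complex_is_Real_iff)
  qed (use ab c_const_nonneg boundary_form[OF assms(9) f(1)] in auto)
  have W: "integral {a..b} w \<noteq> 0"
    using assms(7) by (simp add: lebesgue_integral_leb[OF w])
  have \<alpha>: "\<alpha> = c_const bd + integral {a..b} (\<lambda>x. \<bar>min 0 (q x)\<bar>)"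
    using assms(10) by (simp add: L1[OF qneg])
  have \<delta>: "\<delta> = 2 + 2 * (integral {a..b} (\<lambda>t. \<bar>w t\<bar>) / \<bar>integral {a..b} w\<bar>)"
    using assms(11) by (simp add: L1[OF w] lebesgue_integral_leb[OF w])
  \<comment> \<open>In \<open>ennreal\<close> the quotient bounding the measure would be infinite
    for \<alpha> = 0. The eigenfunction forces \<alpha> > 0, so the bound is a real number.\<close>
  have pos: "4 * \<alpha> * \<delta>\<^sup>2 > 0"
    using a_priori_bounds(1,2)[OF W \<alpha> \<delta>] by simp
  define E0 where "E0 = {x\<in>{a<..<b}. \<bar>w x\<bar> < \<epsilon>}"
  \<comment> \<open>The end points are added because nothing is known about the size of
    \<open>w\<close> there; they do not change the measure.\<close>
  define E where "E = E0 \<union> {a, b}"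
  have wm: "w \<in> borel_measurable (leb a b)"
    using w by simp
  have "{x \<in> space (leb a b). \<bar>w x\<bar> < \<epsilon>} \<in> sets (leb a b)"
    using wm by measurable
  then have "E0 \<in> sets lebesgue"
    by (simp add: E0_def sets_restrict_space_iff)
  moreover have le: "emeasure lebesgue E0 \<le> ennreal (1 / (4 * \<alpha> * \<delta>\<^sup>2))"
    using assms(13) pos by (simp add: E0_def divide_ennreal[symmetric])
  ultimately have E0: "E0 \<in> lmeasurable"
    by (intro fmeasurableI) (auto simp: le_less_trans)
  have E: "E \<in> lmeasurable"
    unfolding E_def using E0 by (intro fmeasurable.Un) (auto intro: negligible_imp_measurable)
  have "measure lebesgue E \<le> measure lebesgue E0 + measure lebesgue {a, b}"
    unfolding E_def using E0 by (intro measure_Un_le) (auto intro: fmeasurableD)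
  also have "measure lebesgue {a, b} = 0"
    by (intro negligible_imp_measure0) simp
  also have "measure lebesgue E0 \<le> 1 / (4 * \<alpha> * \<delta>\<^sup>2)"
    using le pos E0 by (simp add: emeasure_eq_measure2)
  finally have mE: "measure lebesgue E \<le> 1 / (4 * \<alpha> * \<delta>\<^sup>2)" by simp
  have "E \<subseteq> {a..b}"
    using ab by (auto simp: E_def E0_def)
  then have Eint: "(indicat_real E has_integral measure lebesgue E) {a..b}"
  proof -
    have eq: "(\<lambda>x. if x \<in> {a..b} then indicat_real E x else 0) = indicat_real E"
      using \<open>E \<subseteq> {a..b}\<close> by (auto simp: fun_eq_iff indicator_def)
    have "((\<lambda>x. if x \<in> {a..b} then indicat_real E x else 0) has_integral measure lebesgue E) UNIV"
      unfolding eq using E by (simp only: lmeasurable_iff_has_integral)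
    then show ?thesis
      by (simp only: has_integral_restrict_UNIV)
  qed
  obtain x s where x: "x 0 = a" "x (Suc n) = b" "\<And>k. k \<le> n \<Longrightarrow> x k < x (Suc k)"
    and s: "\<And>k. k \<le> n \<Longrightarrow> AE t in leb (x k) (x (Suc k)). sgn (w t) = s k"
    using assms(8) unfolding has_turning_points_def by blast
  have sgn: "\<exists>N. negligible N \<and> (\<forall>t\<in>{x k..x (Suc k)} - N. sgn (w t) = s k)" if k: "k \<le> n" for k
  proof -
    obtain N where N: "negligible N" "\<And>t. t \<in> {x k<..<x (Suc k)} - N \<Longrightarrow> sgn (w t) = s k"
      by (rule AE_lebesgue_on_imp_negligible[OF s[OF k]]) auto
    show ?thesis
      using N by (intro exI[of _ "N \<union> {x k, x (Suc k)}"]) auto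
  qed
  have E_compl: "\<epsilon> \<le> \<bar>w t\<bar>" if "t \<in> {a..b} - E" for t
  proof -
    have "t \<in> {a<..<b}" "t \<notin> E0"
      using that by (auto simp: E_def)
    then show ?thesis by (simp add: E0_def)
  qed
  have E_int: "indicat_real E integrable_on {a..b}" "integral {a..b} (indicat_real E) \<le> 1 / (4 * \<alpha> * \<delta>\<^sup>2)"
    using Eint mE by (simp_all add: has_integral_iff)
  show ?thesis
    unfolding L1[OF q]
    using eigenvalue_bounds[OF W \<alpha> \<delta> assms(12) E_int(1) E_compl E_int(2) x sgn] by blast
qed

end
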